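(* Let $p$ be a nonzero real number, let $\mathcal A,\mathcal B$ be unital $C^*$-algebras and let $\phi:\mathcal A^{++}\to \mathcal B^{++}$ be a bijective map. Then $\phi$ satisfies \[ \phi(A\,\mathsf{m}_p\, B)=\phi(A)\,\mathsf{m}_p\, \phi(B)\quad\text{for all } A,B\in \mathcal A^{++} \] if and only if there are a Jordan *-isomorphism $J:\mathcal A\to \mathcal B$ and an element $D\in \mathcal B^{++}$ such that \[ \phi(A)=\left(D\,J(A)^p\,D\right)^{\frac1p}\quad\text{for all } A\in \mathcal A^{++}. \]
   Context: All $C^*$-algebras are complex and unital. For a $C^*$-algebra $\mathcal A$, $\mathcal A^{+}$ denotes the set of self-adjoint elements with nonnegative spectrum, and $\mathcal A^{++}$ (the positive definite cone) denotes the set of invertible elements of $\mathcal A^{+}$. Real powers of elements of $\mathcal A^{++}$ are defined by continuous functional calculus. For nonzero real $p$, the conventional $p$th power mean on $\mathcal A^{++}$ is \[ A\,\mathsf{m}_p\, B=\left(\frac{A^p+B^p}{2}\right)^{\frac1p},\quad A,B\in \mathcal A^{++} \] (and likewise on $\mathcal B^{++}$). A Jordan *-isomorphism $J:\mathcal A\to\mathcal B$ is a bijective (complex-)linear map satisfying $J(AB+BA)=J(A)J(B)+J(B)J(A)$ and $J(A^* )=J(A)^*$ for all $A,B\in\mathcal A$. *)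

theory Defs
  imports "HOL-Analysis.Analysis"
begin

(* A type of this class is a complex unital C*-algebra. The real scalar multiplication inherited
   from real_normed_algebra_1 is the restriction of the complex one (scaleR_scaleC). The superclass
   requires 0 \<noteq> 1, so the zero algebra is excluded; its axiom norm 1 = 1 then costs nothing,
   as it follows from the C*-identity. *)
class cstar_algebra = real_normed_algebra_1 + banach +
  fixes scaleC :: "complex \<Rightarrow> 'a \<Rightarrow> 'a" (infixr "*\<^sub>C" 75)
    and star :: "'a \<Rightarrow> 'a"
  assumes scaleC_add_right: "c *\<^sub>C (x + y) = c *\<^sub>C x + c *\<^sub>C y"
    and scaleC_add_left: "(c + d) *\<^sub>C x = c *\<^sub>C x + d *\<^sub>C x"
    and scaleC_scaleC: "c *\<^sub>C (d *\<^sub>C x) = (c * d) *\<^sub>C x"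
    and scaleR_scaleC: "r *\<^sub>R x = complex_of_real r *\<^sub>C x"
    and mult_scaleC_left: "(c *\<^sub>C x) * y = c *\<^sub>C (x * y)"
    and mult_scaleC_right: "x * (c *\<^sub>C y) = c *\<^sub>C (x * y)"
    and norm_scaleC: "norm (c *\<^sub>C x) = cmod c * norm x"
    and star_star: "star (star x) = x"
    and star_add: "star (x + y) = star x + star y"
    and star_scaleC: "star (c *\<^sub>C x) = cnj c *\<^sub>C star x"
    and star_mult: "star (x * y) = star y * star x"
    and cstar_identity: "norm (star x * x) = (norm x)\<^sup>2"

instantiation complex :: cstar_algebra
begin

definition "scaleC_complex = (\<lambda>c x. c * x :: complex)"
definition "star_complex = cnj"

instance
  by standard
    (auto simp: scaleC_complex_def star_complex_def algebra_simps norm_mult power2_eq_square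
      scaleR_conv_of_real)

end

definition two_sided_unit :: "'a::cstar_algebra \<Rightarrow> bool" where
  "two_sided_unit a \<longleftrightarrow> (\<exists>b. a * b = 1 \<and> b * a = 1)"

definition spectrum :: "'a::cstar_algebra \<Rightarrow> complex set" where
  "spectrum a = {z. \<not> two_sided_unit (a - z *\<^sub>C 1)}"

definition positive_cone :: "'a::cstar_algebra set" where
  "positive_cone = {a. star a = a \<and> spectrum a \<subseteq> \<real>\<^sub>\<ge>\<^sub>0}"

definition positive_definite_cone :: "'a::cstar_algebra set" where
  "positive_definite_cone = {a \<in> positive_cone. two_sided_unit a}"

(* F is an isometric unital *-homomorphism from C(spectrum a) sending the identity function to a;
   for normal a there is exactly one. Elements of C(spectrum a) are represented by total functions
   continuous on the spectrum; the first conjunct identifies those agreeing on the spectrum, and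
   nothing is said about F on other functions. *)
definition is_functional_calculus ::
    "'a::cstar_algebra \<Rightarrow> ((complex \<Rightarrow> complex) \<Rightarrow> 'a) \<Rightarrow> bool" where
  "is_functional_calculus a F \<longleftrightarrow>
    (let C = {f. continuous_on (spectrum a) f} in
      (\<forall>f\<in>C. \<forall>g\<in>C. (\<forall>z\<in>spectrum a. f z = g z) \<longrightarrow> F f = F g) \<and>
      (\<forall>f\<in>C. \<forall>g\<in>C. F (\<lambda>z. f z + g z) = F f + F g) \<and>
      (\<forall>c. \<forall>f\<in>C. F (\<lambda>z. c * f z) = c *\<^sub>C F f) \<and>
      (\<forall>f\<in>C. \<forall>g\<in>C. F (\<lambda>z. f z * g z) = F f * F g) \<and>
      (\<forall>f\<in>C. F (\<lambda>z. cnj (f z)) = star (F f)) \<and>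
      (\<forall>f\<in>C. norm (F f) = (SUP z\<in>spectrum a. cmod (f z))) \<and>
      F (\<lambda>z. 1) = 1 \<and>
      F (\<lambda>z. z) = a)"

(* Meaningful for normal a and f continuous on the spectrum of a. *)
definition cfc :: "(complex \<Rightarrow> complex) \<Rightarrow> 'a::cstar_algebra \<Rightarrow> 'a" where
  "cfc f a = (THE b. \<exists>F. is_functional_calculus a F \<and> F f = b)"

(* For a in the positive definite cone the spectrum lies in the open positive half-line, so the
   function applied to a is t \<mapsto> t powr p. *)
definition real_power :: "'a::cstar_algebra \<Rightarrow> real \<Rightarrow> 'a" where
  "real_power a p = cfc (\<lambda>z. complex_of_real (Re z powr p)) a"

definition power_mean :: "real \<Rightarrow> 'a::cstar_algebra \<Rightarrow> 'a \<Rightarrow> 'a" where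
  "power_mean p A B = real_power ((real_power A p + real_power B p) /\<^sub>R 2) (1 / p)"

definition jordan_star_isomorphism :: "('a::cstar_algebra \<Rightarrow> 'b::cstar_algebra) \<Rightarrow> bool" where
  "jordan_star_isomorphism J \<longleftrightarrow>
    bij J \<and>
    (\<forall>A B. J (A + B) = J A + J B) \<and>
    (\<forall>c A. J (c *\<^sub>C A) = c *\<^sub>C J A) \<and>
    (\<forall>A B. J (A * B + B * A) = J A * J B + J B * J A) \<and>
    (\<forall>A. J (star A) = star (J A))"

end

theory Submission
  imports Defs "HOL-Computational_Algebra.Fundamental_Theorem_Algebra"
begin

text \<open>Conjugating \<open>\<phi>\<close> with the power function turns preservation of the power mean into preservation
  of the arithmetic mean: \<open>\<psi>(A) = \<phi>(A\<^bsup>1/p\<^esup>)\<^bsup>p\<^esup>\<close> is a midpoint-affine bijection of the positive definite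
  cones. Since \<open>\<psi>\<close> and its inverse have positive values, \<open>\<psi>\<close> is the restriction of a real-linear order
  isomorphism \<open>T\<close> of the self-adjoint parts, with no constant term. With \<open>D = T(1)\<^bsup>1/2\<^esup>\<close>, the map
  \<open>D\<^bsup>-1\<^esup> T(\<cdot>) D\<^bsup>-1\<^esup>\<close> is a unital order isomorphism; Kadison's inequality \<open>S(a\<^sup>2) \<ge> S(a)\<^sup>2\<close>, applied to it and
  to its inverse, shows that it preserves squares and so extends to a Jordan *-isomorphism. Conversely,
  Jordan *-isomorphisms preserve spectra and commute with the functional calculus.\<close>

section \<open>Spectra in \<open>C*\<close>-algebras\<close>

text \<open>Everything rests on one fact: a self-adjoint element has a spectral value whose modulus
  is its norm. It makes polynomials in \<open>a\<close> isometric to polynomials on the spectrum,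
  which gives the functional calculus, and it turns order bounds into norm bounds. Kadison's
  inequality is obtained from mere positivity because only functions of a single element
  \<open>a\<close> are fed to the map, so a finite partition of unity with scalar nodes suffices.
  Midpoint affinity yields only rational homogeneity; real homogeneity is forced by positivity,
  which bounds the additive error on the interval from 0 to 1. As 0 is not in the positive definite
  cone, the constant of an affine map on it cannot be read off at 0; it is a positive element,
  approached by values at small multiples of 1, and vanishes only because the inverse map has a
  positive constant too. The factor \<open>D\<close> is invertible because \<open>T 1\<close> is a
  value of the bijection, hence positive definite.\<close>

lemma scaleC_zero_left [simp]: "0 *\<^sub>C (x::'a::cstar_algebra) = 0"
  using scaleR_scaleC[of 0 x] by simp

lemma scaleC_one [simp]: "1 *\<^sub>C (x::'a::cstar_algebra) = x"
  using scaleR_scaleC[of 1 x] by simp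

lemma scaleC_zero_right [simp]: "c *\<^sub>C (0::'a::cstar_algebra) = 0"
  using scaleC_add_right[of c 0 "0::'a"] by simp

lemma scaleC_minus_left: "(- c) *\<^sub>C (x::'a::cstar_algebra) = - (c *\<^sub>C x)"
  using scaleC_add_left[of c "-c" x] by (simp add: add_eq_0_iff)

lemma scaleC_minus_right: "c *\<^sub>C (- x::'a::cstar_algebra) = - (c *\<^sub>C x)"
  using scaleC_add_right[of c x "-x"] by (simp add: add_eq_0_iff)

lemma scaleC_diff_left: "(c - d) *\<^sub>C (x::'a::cstar_algebra) = c *\<^sub>C x - d *\<^sub>C x"
  using scaleC_add_left[of c "-d" x] by (simp add: scaleC_minus_left)

lemma scaleC_diff_right: "c *\<^sub>C (x - y::'a::cstar_algebra) = c *\<^sub>C x - c *\<^sub>C y"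
  using scaleC_add_right[of c x "-y"] by (simp add: scaleC_minus_right)

lemma bounded_bilinear_scaleC: "bounded_bilinear (\<lambda>c (x::'a::cstar_algebra). c *\<^sub>C x)"
proof
  show "(r *\<^sub>R a) *\<^sub>C b = r *\<^sub>R a *\<^sub>C b" for r a and b :: 'a
    by (simp add: scaleR_scaleC[where 'a='a] scaleC_scaleC scaleR_conv_of_real)
  show "a *\<^sub>C (r *\<^sub>R b) = r *\<^sub>R a *\<^sub>C b" for r a and b :: 'a
    by (simp add: scaleR_scaleC[where 'a='a] scaleC_scaleC mult.commute)
  show "\<exists>K. \<forall>a (b::'a). norm (a *\<^sub>C b) \<le> norm a * norm b * K"
    by (rule exI[of _ 1]) (simp add: norm_scaleC)
qed (simp_all add: scaleC_add_left scaleC_add_right)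

lemmas tendsto_scaleC [tendsto_intros] = bounded_bilinear.tendsto[OF bounded_bilinear_scaleC]
lemmas continuous_on_scaleC [continuous_intros] =
  bounded_bilinear.continuous_on[OF bounded_bilinear_scaleC]

lemma star_zero [simp]: "star (0::'a::cstar_algebra) = 0"
  using star_add[of 0 "0::'a"] by simp

lemma star_one [simp]: "star (1::'a::cstar_algebra) = 1"
  by (metis mult.right_neutral mult.left_neutral star_mult star_star)

lemma star_minus: "star (- x::'a::cstar_algebra) = - star x"
  using star_add[of x "-x"] by (simp add: add_eq_0_iff)

lemma star_diff: "star (x - y::'a::cstar_algebra) = star x - star y"
  using star_add[of x "-y"] by (simp add: star_minus)

lemma star_scaleR: "star (r *\<^sub>R (x::'a::cstar_algebra)) = r *\<^sub>R star x"
  by (simp add: scaleR_scaleC star_scaleC)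

lemma star_power: "star ((x::'a::cstar_algebra) ^ n) = star x ^ n"
  by (induction n) (simp_all add: star_mult power_commutes)

lemma star_sum: "star (sum f A :: 'a::cstar_algebra) = (\<Sum>i\<in>A. star (f i))"
  by (induction A rule: infinite_finite_induct) (simp_all add: star_add)

text \<open>The C*-identity gives \<open>(norm y)^2 \<le> norm (star y) * norm y\<close>. Cancelling
  one factor proves one bound, and replacing \<open>y\<close> by its adjoint proves the
  other.\<close>

lemma norm_star [simp]: "norm (star (x::'a::cstar_algebra)) = norm x"
proof -
  have le: "norm y \<le> norm (star y)" for y :: 'a
  proof (cases "y = 0")
    case False
    have "norm y * norm y \<le> norm (star y) * norm y"
      using cstar_identity[of y] norm_mult_ineq[of "star y" y] by (simp add: power2_eq_square)
    then show ?thesis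
      using False by simp
  qed simp
  show ?thesis
    using le[of x] le[of "star x"] by (simp add: star_star)
qed

lemma bounded_linear_star: "bounded_linear (star :: 'a::cstar_algebra \<Rightarrow> 'a)"
  by (rule bounded_linear_intro[of _ 1]) (simp_all add: star_add star_scaleR)

lemmas tendsto_star [tendsto_intros] = bounded_linear.tendsto[OF bounded_linear_star]

lemma norm_selfadjoint_square: "star a = a \<Longrightarrow> norm (a * a) = (norm (a::'a::cstar_algebra))\<^sup>2"
  using cstar_identity[of a] by simp

section \<open>Invertible elements and the Neumann series\<close>

lemma two_sided_unit_one [simp]: "two_sided_unit 1"
  unfolding two_sided_unit_def by (intro exI[of _ 1]) simp

lemma two_sided_unit_mult:
  assumes "two_sided_unit a" "two_sided_unit b"
  shows "two_sided_unit (a * b)"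
proof -
  obtain c d where c: "a * c = 1" "c * a = 1" and d: "b * d = 1" "d * b = 1"
    using assms unfolding two_sided_unit_def by blast
  have "(a * b) * (d * c) = a * (b * d) * c" "(d * c) * (a * b) = d * (c * a) * b"
    by (simp_all only: mult.assoc)
  then show ?thesis
    unfolding two_sided_unit_def using c d by (intro exI[of _ "d * c"]) simp
qed

lemma two_sided_unitI:
  assumes "b * a = 1" "a * c = 1"
  shows "two_sided_unit a"
proof -
  have "b = b * (a * c)" using assms by simp
  also have "\<dots> = (b * a) * c" by (simp only: mult.assoc)
  also have "\<dots> = c" using assms by simp
  finally show ?thesis using assms unfolding two_sided_unit_def by blast
qed

text \<open>If \<open>c\<close> inverts the product, then \<open>b * c\<close> is a right inverse of
  \<open>a\<close>, and commutation makes \<open>c * b\<close> a left inverse.\<close>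

lemma two_sided_unit_commuting_factor:
  assumes "two_sided_unit (a * b)" "a * b = b * a"
  shows "two_sided_unit a"
proof -
  obtain c where "(a * b) * c = 1" "c * (a * b) = 1"
    using assms(1) unfolding two_sided_unit_def by blast
  moreover from this have "(c * b) * a = 1"
    using assms(2) by (simp add: mult.assoc)
  ultimately have "a * (b * c) = 1" "(c * b) * a = 1"
    by (simp_all only: mult.assoc)
  then show ?thesis by (rule two_sided_unitI[rotated])
qed

lemma two_sided_unit_scaleC:
  assumes "two_sided_unit a" "c \<noteq> 0"
  shows "two_sided_unit (c *\<^sub>C a)"
proof -
  obtain b where "a * b = 1" "b * a = 1"
    using assms(1) unfolding two_sided_unit_def by blast
  then show ?thesis using assms(2) unfolding two_sided_unit_def
    by (intro exI[of _ "inverse c *\<^sub>C b"]) (simp add: mult_scaleC_left mult_scaleC_right scaleC_scaleC)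
qed

lemma two_sided_unit_scaleC_iff: "c \<noteq> 0 \<Longrightarrow> two_sided_unit (c *\<^sub>C a) \<longleftrightarrow> two_sided_unit a"
  using two_sided_unit_scaleC[of a c] two_sided_unit_scaleC[of "c *\<^sub>C a" "inverse c"]
  by (auto simp: scaleC_scaleC)

text \<open>The inverse is the Neumann series. Both the boundedness and the closedness of spectra
  come from it.\<close>

lemma two_sided_unit_one_minus:
  fixes x :: "'a::cstar_algebra"
  assumes "norm x < 1"
  shows "two_sided_unit (1 - x)"
proof -
  define s where "s = (\<Sum>n. x ^ n)"
  have sums: "(\<lambda>n. x ^ n) sums s"
    unfolding s_def by (rule summable_sums[OF complete_algebra_summable_geometric[OF assms]])
  have lim: "(\<lambda>n. x * x ^ n) sums (x * s)" "(\<lambda>n. x ^ n * x) sums (s * x)"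
    using sums_mult[OF sums] sums_mult2[OF sums] by blast+
  have "(\<lambda>n. x ^ Suc n) sums (s - 1)"
    using sums by (subst sums_Suc_iff) simp
  then have "x * s = s - 1" "s * x = s - 1"
    using lim sums_unique2 by (auto simp: power_commutes)
  then show ?thesis
    unfolding two_sided_unit_def by (intro exI[of _ s]) (simp add: algebra_simps)
qed

lemma spectrum_norm_le:
  fixes a :: "'a::cstar_algebra"
  assumes "z \<in> spectrum a"
  shows "cmod z \<le> norm a"
proof (rule ccontr)
  assume neg: "\<not> ?thesis"
  then have z: "z \<noteq> 0" by auto
  have "norm (inverse z *\<^sub>C a) < 1"
    using neg z by (simp add: norm_scaleC norm_inverse norm_divide field_simps)
  then have "two_sided_unit ((- z) *\<^sub>C (1 - inverse z *\<^sub>C a))"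
    using two_sided_unit_one_minus z by (intro two_sided_unit_scaleC) auto
  moreover have "(- z) *\<^sub>C (1 - inverse z *\<^sub>C a) = a - z *\<^sub>C 1"
    using z by (simp add: scaleC_diff_right scaleC_scaleC scaleC_minus_left)
  ultimately show False using assms by (simp add: spectrum_def)
qed

text \<open>The product \<open>a' * b = 1 - (a - a') * b\<close> is invertible by the Neumann
  series, and multiplying by \<open>a\<close> recovers \<open>a'\<close>.\<close>

lemma two_sided_unit_perturb:
  fixes a :: "'a::cstar_algebra"
  assumes "a * b = 1" "b * a = 1" "norm (a' - a) * norm b < 1"
  shows "two_sided_unit a'"
proof -
  have "norm ((a - a') * b) < 1"
    using norm_mult_ineq[of "a - a'" b] assms(3) by (simp add: norm_minus_commute)
  then have "two_sided_unit (1 - (a - a') * b)"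
    by (rule two_sided_unit_one_minus)
  moreover have "1 - (a - a') * b = a' * b"
    using assms by (simp add: algebra_simps)
  moreover have "two_sided_unit a"
    using assms unfolding two_sided_unit_def by blast
  ultimately have "two_sided_unit (a' * b * a)"
    by (simp add: two_sided_unit_mult)
  then show ?thesis using assms by (simp add: mult.assoc)
qed

lemma open_two_sided_unit: "open {a::'a::cstar_algebra. two_sided_unit a}"
proof (subst open_dist, safe)
  fix a :: 'a assume "two_sided_unit a"
  then obtain b where b: "a * b = 1" "b * a = 1"
    unfolding two_sided_unit_def by blast
  have "b \<noteq> 0" using b by auto
  then have "\<forall>y. dist y a < inverse (norm b) \<longrightarrow> two_sided_unit y"
    using two_sided_unit_perturb[OF b] by (simp add: dist_norm field_simps)
  then show "\<exists>e>0. \<forall>y. dist y a < e \<longrightarrow> y \<in> Collect two_sided_unit"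
    using \<open>b \<noteq> 0\<close> by (intro exI[of _ "inverse (norm b)"]) auto
qed

lemma closed_spectrum: "closed (spectrum (a::'a::cstar_algebra))"
proof -
  have "continuous_on UNIV (\<lambda>z. a - z *\<^sub>C 1)"
    by (intro continuous_intros)
  then have "open ((\<lambda>z. a - z *\<^sub>C 1) -` {a. two_sided_unit a})"
    using open_two_sided_unit continuous_on_open_vimage[of UNIV "\<lambda>z. a - z *\<^sub>C 1"] by auto
  moreover have "- spectrum a = (\<lambda>z. a - z *\<^sub>C 1) -` {a. two_sided_unit a}"
    by (auto simp: spectrum_def)
  ultimately show ?thesis by (simp add: closed_def)
qed

lemma compact_spectrum: "compact (spectrum (a::'a::cstar_algebra))"
proof -
  have "spectrum a \<subseteq> cball 0 (norm a)"
    using spectrum_norm_le by (auto simp: dist_norm)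
  then show ?thesis
    by (meson bounded_cball bounded_subset closed_spectrum compact_eq_bounded_closed)
qed

text \<open>For \<open>z = \<alpha> + i \<beta>\<close> in the spectrum, \<open>z + i t\<close> lies in the spectrum of \<open>a + i t\<close>, so
  \<open>\<alpha>\<^sup>2 + (\<beta> + t)\<^sup>2 \<le> \<parallel>a + i t\<parallel>\<^sup>2 \<le> \<parallel>a\<parallel>\<^sup>2 + t\<^sup>2\<close> for all real \<open>t\<close>.\<close>

lemma spectrum_selfadjoint_real:
  fixes a :: "'a::cstar_algebra"
  assumes "star a = a" "z \<in> spectrum a"
  shows "Im z = 0"
proof -
  have ineq: "2 * Im z * t \<le> (norm a)\<^sup>2" for t :: real
  proof -
    let ?c = "\<i> * complex_of_real t"
    let ?b = "a + ?c *\<^sub>C 1"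
    have "z + ?c \<in> spectrum ?b"
      using assms(2) by (simp add: spectrum_def scaleC_add_left algebra_simps)
    then have "(cmod (z + ?c))\<^sup>2 \<le> (norm ?b)\<^sup>2"
      using spectrum_norm_le by (intro power_mono) auto
    also have "\<dots> = norm (star ?b * ?b)"
      by (simp add: cstar_identity)
    also have "star ?b * ?b = a * a + complex_of_real (t\<^sup>2) *\<^sub>C 1"
      using assms(1) by (simp add: star_add star_scaleC algebra_simps mult_scaleC_left mult_scaleC_right
          scaleC_scaleC scaleC_minus_left scaleC_diff_right power2_eq_square)
    also have "norm \<dots> \<le> norm (a * a) + t\<^sup>2"
      by (rule norm_triangle_le) (simp add: norm_scaleC norm_mult power2_eq_square)
    also have "\<dots> = (norm a)\<^sup>2 + t\<^sup>2"
      using assms(1) by (simp add: norm_selfadjoint_square)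
    finally have "(Re z)\<^sup>2 + (Im z + t)\<^sup>2 \<le> (norm a)\<^sup>2 + t\<^sup>2"
      by (simp add: cmod_power2)
    then show ?thesis
      by (simp add: power2_sum) (smt (verit) zero_le_power2 mult.commute mult.left_commute)
  qed
  show ?thesis
  proof (rule ccontr)
    assume nz: "Im z \<noteq> 0"
    \<comment> \<open>The bound \<open>ineq\<close> is linear in the parameter on the left and
      constant on the right; this value overshoots the right side by 1.\<close>
    have "2 * Im z * (((norm a)\<^sup>2 + 1) / (2 * Im z)) = (norm a)\<^sup>2 + 1"
      using nz by simp
    then show False using ineq[of "((norm a)\<^sup>2 + 1) / (2 * Im z)"] by linarith
  qed
qed

text \<open>On self-adjoint elements the C*-identity says that squaring squares the norm. Repeated
  squaring reaches the exponents \<open>2 ^ k\<close>, which is what a spectral radius argument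
  requires.\<close>

lemma norm_selfadjoint_power:
  fixes a :: "'a::cstar_algebra"
  assumes "star a = a"
  shows "norm (a ^ (2 ^ k)) = norm a ^ (2 ^ k)"
proof (induction k)
  case (Suc k)
  have "norm (a ^ (2 ^ Suc k)) = norm (a ^ (2 ^ k) * a ^ (2 ^ k))"
    by (simp flip: power_add add: mult_2)
  also have "\<dots> = (norm (a ^ (2 ^ k)))\<^sup>2"
    using assms by (intro norm_selfadjoint_square) (simp add: star_power)
  finally show ?case
    by (simp add: Suc.IH power_mult mult.commute[of 2])
qed simp

text \<open>The identity \<open>b' - b = b' * (a - a') * b\<close> bounds the difference by
  \<open>norm b' / 2\<close>, so \<open>norm b' \<le> 2 * norm b\<close>; inserting this into the
  same identity gives the estimate.\<close>

lemma inverse_close: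
  fixes a :: "'a::cstar_algebra"
  assumes "b * a = 1" "a' * b' = 1" "b' * a' = 1" "a * b = 1" "norm (a' - a) * norm b \<le> 1/2"
  shows "norm (b' - b) \<le> 2 * (norm b)\<^sup>2 * norm (a' - a)"
proof -
  have eq: "b' - b = b' * (a - a') * b"
    using assms by (simp add: algebra_simps mult.assoc)
  have le: "norm (b' - b) \<le> norm b' * (norm (a' - a) * norm b)"
    unfolding eq mult.assoc
    by (metis (no_types, opaque_lifting) norm_minus_commute norm_mult_ineq order_trans mult_left_mono norm_ge_zero)
  also have "\<dots> \<le> norm b' * (1/2)"
    using assms(5) by (intro mult_left_mono) auto
  finally have "norm b' \<le> 2 * norm b"
    using norm_triangle_ineq2[of b' b] by linarith
  then have "norm b' * (norm (a' - a) * norm b) \<le> (2 * norm b) * (norm (a' - a) * norm b)"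
    by (intro mult_right_mono) auto
  then show ?thesis using le by (simp add: power2_eq_square algebra_simps)
qed

lemma continuous_on_algebra_inverse:
  fixes f :: "'c::metric_space \<Rightarrow> 'a::cstar_algebra"
  assumes cont: "continuous_on S f"
    and inv: "\<And>z. z \<in> S \<Longrightarrow> f z * g z = 1" "\<And>z. z \<in> S \<Longrightarrow> g z * f z = 1"
  shows "continuous_on S g"
proof (rule continuous_on_iff[THEN iffD2], intro ballI allI impI)
  fix x and e :: real assume x: "x \<in> S" and e: "e > 0"
  have gx: "norm (g x) > 0" using inv[OF x] by auto
  \<comment> \<open>The first bound makes \<open>inverse_close\<close> applicable, the second makes
    its estimate at most \<open>e / 2\<close>.\<close>
  define r where "r = min (1 / (2 * norm (g x))) (e / (4 * (norm (g x))\<^sup>2))"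
  have r: "r > 0" using gx e by (simp add: r_def)
  obtain d where d: "d > 0" "\<And>y. y \<in> S \<Longrightarrow> dist y x < d \<Longrightarrow> dist (f y) (f x) < r"
    using cont x r unfolding continuous_on_iff by blast
  have "dist (g y) (g x) < e" if y: "y \<in> S" "dist y x < d" for y
  proof -
    have lt: "norm (f y - f x) < r" using d(2)[OF y] by (simp add: dist_norm)
    have "norm (f y - f x) * norm (g x) \<le> r * norm (g x)"
      using lt by (intro mult_right_mono) auto
    also have "\<dots> \<le> 1 / (2 * norm (g x)) * norm (g x)"
      by (intro mult_right_mono) (auto simp: r_def)
    also have "\<dots> = 1/2" using gx by simp
    finally have "norm (g y - g x) \<le> 2 * (norm (g x))\<^sup>2 * norm (f y - f x)"
      by (intro inverse_close) (use inv x y in auto)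
    also have "\<dots> \<le> 2 * (norm (g x))\<^sup>2 * (e / (4 * (norm (g x))\<^sup>2))"
      using lt by (intro mult_left_mono) (auto simp: r_def)
    also have "\<dots> = e / 2" using gx by (simp add: field_simps)
    finally show ?thesis using e by (simp add: dist_norm)
  qed
  then show "\<exists>d>0. \<forall>x'\<in>S. dist x' x < d \<longrightarrow> dist (g x') (g x) < e"
    using d(1) by blast
qed

lemma complex_power_root_exists:
  assumes "n > 0"
  shows "\<exists>w::complex. w ^ n = c \<and> cmod w ^ n = cmod c"
proof (cases "c = 0")
  case False
  have "exp (Ln c / of_nat n) ^ n = exp (of_nat n * (Ln c / of_nat n))"
    by (simp only: exp_of_nat_mult)
  also have "\<dots> = c" using assms False by simp
  finally show ?thesis by (metis norm_power)
qed (use assms in auto)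

text \<open>If the resolvent existed on the whole circle of radius \<open>\<parallel>a\<parallel>\<close>, it would be uniformly
  continuous in \<open>z\<close>. The inverse of \<open>1 - (z a)\<^bsup>2^k\<^esup>\<close> is an average of resolvents, hence
  uniformly continuous with the same modulus for every \<open>k\<close>; but slightly inside the circle it tends
  to \<open>1\<close>, whereas \<open>\<parallel>a\<^bsup>2^k\<^esup>\<parallel> = 1\<close> keeps it away from \<open>1\<close> on the circle.\<close>

lemma spectrum_unit_norm:
  fixes a :: "'a::cstar_algebra"
  assumes sa: "star a = a" and norm1: "norm a = 1"
  shows "\<exists>z. cmod z \<le> 1 \<and> \<not> two_sided_unit (1 - z *\<^sub>C a)"
proof (rule ccontr)
  assume "\<not> ?thesis"
  then have "\<forall>z\<in>cball 0 1. \<exists>b. (1 - z *\<^sub>C a) * b = 1 \<and> b * (1 - z *\<^sub>C a) = 1"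
    by (auto simp: two_sided_unit_def dist_norm)
  then obtain R where R: "\<And>z. z \<in> cball 0 1 \<Longrightarrow> (1 - z *\<^sub>C a) * R z = 1"
      "\<And>z. z \<in> cball 0 1 \<Longrightarrow> R z * (1 - z *\<^sub>C a) = 1"
    by metis
  have "continuous_on (cball 0 1) R"
    by (rule continuous_on_algebra_inverse[of _ "\<lambda>z. 1 - z *\<^sub>C a"]) (auto intro!: continuous_intros R)
  then have "uniformly_continuous_on (cball 0 1) R"
    by (simp add: compact_uniformly_continuous)
  then obtain d where d: "d > 0"
    "\<And>z w. z \<in> cball 0 1 \<Longrightarrow> w \<in> cball 0 1 \<Longrightarrow> dist w z < d \<Longrightarrow> dist (R w) (R z) < 1/4"
    unfolding uniformly_continuous_on_def by (metis zero_less_divide_1_iff zero_less_numeral)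
  \<comment> \<open>A radius below 1 whose distance to 1 is less than \<open>d\<close>; the maximum
    with 0 covers large \<open>d\<close>.\<close>
  define t where "t = max 0 (1 - d/2)"
  have t: "0 \<le> t" "t < 1" "1 - t < d" using d(1) by (auto simp: t_def)
  \<comment> \<open>\<open>b\<close> and \<open>b'\<close> invert \<open>1 - (z a)^(2^k)\<close> at
    the points \<open>z\<close> and \<open>t z\<close>. The bound 1/4 on their distance must not
    deteriorate with \<open>k\<close>; averaging preserves it.\<close>
  define P where "P k z b b' \<longleftrightarrow>
      (1 - z ^ 2^k *\<^sub>C a ^ 2^k) * b = 1 \<and> b * (1 - z ^ 2^k *\<^sub>C a ^ 2^k) = 1 \<and>
      (1 - (of_real t * z) ^ 2^k *\<^sub>C a ^ 2^k) * b' = 1 \<and> b' * (1 - (of_real t * z) ^ 2^k *\<^sub>C a ^ 2^k) = 1 \<and>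
      norm (b - b') \<le> 1/4" for k z b b'
  have inv: "\<exists>b b'. P k z b b'" if "cmod z \<le> 1" for k z
    using that
  proof (induction k arbitrary: z)
    case 0
    have tz: "cmod (of_real t * z) \<le> 1"
      using 0 t by (simp add: norm_mult mult_le_one)
    have "z - of_real t * z = of_real (1 - t) * z" by (simp add: algebra_simps)
    then have "cmod (z - of_real t * z) \<le> 1 - t"
      using 0 t by (simp only: norm_mult norm_of_real) (simp add: mult_left_le)
    then have "dist (R z) (R (of_real t * z)) < 1/4"
      using 0 tz t by (intro d(2)) (auto simp: dist_norm)
    then show ?case using R 0 tz
      by (intro exI[of _ "R z"] exI[of _ "R (of_real t * z)"]) (simp add: P_def dist_norm)
  next
    case (Suc k)
    \<comment> \<open>Multiplying \<open>z\<close> by this root turns \<open>u = (z a)^(2^k)\<close>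
      into \<open>- u\<close>, and the average of the inverses of \<open>1 - u\<close> and
      \<open>1 + u\<close> is the inverse of \<open>1 - u * u\<close>, the element for
      \<open>k + 1\<close>.\<close>
    obtain w :: complex where w: "w ^ 2 ^ k = - 1" "cmod w ^ 2 ^ k = 1"
      using complex_power_root_exists[of "2 ^ k" "-1"] by auto
    then have "cmod w = 1" using power_eq_imp_eq_base[of "cmod w" "2 ^ k" 1] by simp
    then have "cmod (w * z) \<le> 1" using Suc.prems by (simp add: norm_mult)
    then obtain c c' where c: "P k (w * z) c c'" using Suc.IH by blast
    obtain b b' where b: "P k z b b'" using Suc by blast
    have sq: "(1 - s ^ 2^Suc k *\<^sub>C a ^ 2^Suc k) * ((x + y) /\<^sub>R 2) = 1 \<and>
              ((x + y) /\<^sub>R 2) * (1 - s ^ 2^Suc k *\<^sub>C a ^ 2^Suc k) = 1"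
      if x: "(1 - s ^ 2^k *\<^sub>C a ^ 2^k) * x = 1" "x * (1 - s ^ 2^k *\<^sub>C a ^ 2^k) = 1"
      and y: "(1 - (w * s) ^ 2^k *\<^sub>C a ^ 2^k) * y = 1" "y * (1 - (w * s) ^ 2^k *\<^sub>C a ^ 2^k) = 1" for s x y
    proof -
      define u where "u = s ^ 2^k *\<^sub>C a ^ 2^k"
      have uu: "s ^ 2^Suc k *\<^sub>C a ^ 2^Suc k = u * u"
        by (simp add: u_def mult_scaleC_left mult_scaleC_right scaleC_scaleC flip: power_add mult_2)
      have wu: "(w * s) ^ 2^k *\<^sub>C a ^ 2^k = - u"
        using w by (simp add: u_def power_mult_distrib scaleC_minus_left)
      have f: "1 - u * u = (1 + u) * (1 - u)" "1 - u * u = (1 - u) * (1 + u)"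
        by (simp_all add: algebra_simps)
      have x': "(1 - u) * x = 1" "x * (1 - u) = 1" using x by (simp_all add: u_def)
      have y': "(1 + u) * y = 1" "y * (1 + u) = 1" using y by (simp_all add: wu)
      have "(1 - u * u) * x = 1 + u" using x' by (simp add: f(1) mult.assoc)
      moreover have "(1 - u * u) * y = 1 - u" using y' by (simp add: f(2) mult.assoc)
      moreover have "x * (1 - u * u) = 1 + u" using x' by (simp add: f(2) flip: mult.assoc)
      moreover have "y * (1 - u * u) = 1 - u" using y' by (simp add: f(1) flip: mult.assoc)
      moreover have "(1 / 2) *\<^sub>R (2::'a) = 1"
        by (metis one_add_one scaleR_half_double)
      ultimately show ?thesis
        unfolding uu by (simp only: distrib_left distrib_right mult_scaleR_left mult_scaleR_right) simp
    qed
    have "norm ((b + c) /\<^sub>R 2 - (b' + c') /\<^sub>R 2) = norm ((b - b') + (c - c')) / 2"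
      by (simp flip: scaleR_diff_right) (simp add: algebra_simps)
    also have "\<dots> \<le> 1/4"
      using b c norm_triangle_ineq[of "b - b'" "c - c'"] by (simp add: P_def)
    finally have "P (Suc k) z ((b + c) /\<^sub>R 2) ((b' + c') /\<^sub>R 2)"
      using b c sq[of z b c] sq[of "of_real t * z" b' c'] unfolding P_def
      by (simp add: mult.left_commute)
    then show ?case by blast
  qed
  have "(\<lambda>n. t ^ n) \<longlonglongrightarrow> 0"
    using t by (intro LIMSEQ_power_zero) auto
  then obtain N where N: "\<And>n. n \<ge> N \<Longrightarrow> t ^ n < 1/10"
    using order_tendstoD(2)[of "\<lambda>n. t ^ n" 0 sequentially "1/10"] by (auto simp: eventually_sequentially)
  \<comment> \<open>With \<open>norm y' \<le> 1/10\<close> the inverse \<open>b'\<close> is within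
    1/9 of 1, so \<open>b\<close> is within 1/4 + 1/9. Since \<open>y = (1 - y) * (b - 1)\<close>
    and \<open>norm (1 - y) \<le> 2\<close>, this forces \<open>norm y \<le> 13/18\<close>,
    contradicting \<open>norm y = 1\<close>.\<close>
  have "t ^ 2 ^ N < 1/10" by (rule N) (simp add: less_imp_le)
  define y y' where "y = a ^ 2 ^ N" and "y' = of_real t ^ 2^N *\<^sub>C a ^ 2^N"
  have ny: "norm y = 1" "norm y' \<le> 1/10"
    using norm_selfadjoint_power[OF sa] norm1 t \<open>t ^ 2 ^ N < 1/10\<close>
    by (simp_all add: y_def y'_def norm_scaleC norm_power)
  obtain b b' where b: "(1 - y) * b = 1" "b' * (1 - y') = 1" "norm (b - b') \<le> 1/4"
    using inv[of 1 N] by (auto simp: P_def y_def y'_def)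
  have b': "b' - 1 = b' * y'" using b(2) by (simp add: algebra_simps)
  have n1: "norm (b' - 1) \<le> norm b' / 10"
    unfolding b' using norm_mult_ineq[of b' y'] mult_left_mono[OF ny(2), of "norm b'"] by simp
  then have "norm b' \<le> 10/9"
    using norm_triangle_ineq2[of b' 1] by simp
  then have "norm (b - 1) \<le> 1/4 + 1/9"
    using n1 b(3) norm_triangle_ineq[of "b - b'" "b' - 1"] by simp
  moreover have "y = (1 - y) * (b - 1)" using b(1) by (simp add: algebra_simps)
  then have "norm y \<le> norm (1 - y) * norm (b - 1)"
    using norm_mult_ineq by metis
  moreover have "norm (1 - y) \<le> 2"
    using norm_triangle_ineq4[of 1 y] ny by simp
  ultimately have "norm y \<le> 2 * (1/4 + 1/9)"
    by (meson mult_mono norm_ge_zero order_trans zero_le_numeral)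
  then show False using ny by simp
qed

text \<open>After scaling to norm 1, a singular \<open>1 - z a\<close> with \<open>z\<close> in the
  closed unit disc becomes the spectral value \<open>1 / z\<close>, of modulus at least 1; the norm
  bound on the spectrum gives equality.\<close>

lemma spectrum_attains_norm:
  fixes a :: "'a::cstar_algebra"
  assumes "star a = a"
  shows "\<exists>z\<in>spectrum a. cmod z = norm a"
proof (cases "a = 0")
  case True
  have "\<not> two_sided_unit (0::'a)" by (simp add: two_sided_unit_def)
  then show ?thesis using True by (intro bexI[of _ 0]) (auto simp: spectrum_def)
next
  case False
  define r where "r = inverse (norm a)"
  have r: "r > 0" using False by (simp add: r_def)
  obtain z where z: "cmod z \<le> 1" "\<not> two_sided_unit (1 - z *\<^sub>C (r *\<^sub>R a))"
    using spectrum_unit_norm[of "r *\<^sub>R a"] assms False by (auto simp: star_scaleR r_def)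
  have z0: "z \<noteq> 0" using z(2) by auto
  define l where "l = inverse (z * of_real r)"
  have l: "l \<noteq> 0" using z0 r by (simp add: l_def)
  have "a - l *\<^sub>C 1 = (- l) *\<^sub>C (1 - z *\<^sub>C (r *\<^sub>R a))"
    using l by (simp add: scaleR_scaleC scaleC_diff_right scaleC_scaleC scaleC_minus_left)
      (simp add: l_def field_simps)
  then have "l \<in> spectrum a"
    using z(2) l two_sided_unit_scaleC_iff[of "-l" "1 - z *\<^sub>C (r *\<^sub>R a)"] by (simp add: spectrum_def)
  moreover have "cmod l \<ge> norm a"
    using z(1) z0 r by (simp add: l_def norm_mult norm_inverse norm_divide r_def divide_simps mult_left_le)
  ultimately show ?thesis using spectrum_norm_le by (intro bexI[of _ l]) (auto intro: antisym)
qed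

section \<open>Continuous functional calculus for self-adjoint elements\<close>

text \<open>Horner evaluation: \<open>poly\<close> itself does not apply, as coefficients are
  complex while the argument lies in the algebra.\<close>

definition poly_at :: "complex poly \<Rightarrow> 'a::cstar_algebra \<Rightarrow> 'a" where
  "poly_at q a = fold_coeffs (\<lambda>c b. c *\<^sub>C 1 + a * b) q 0"

lemma poly_at_0 [simp]: "poly_at 0 a = 0"
  by (simp add: poly_at_def)

lemma poly_at_pCons [simp]: "poly_at (pCons c q) a = c *\<^sub>C 1 + a * poly_at q a"
  by (cases "q = 0 \<and> c = 0") (auto simp: poly_at_def)

lemma poly_at_add [simp]: "poly_at (p + q) a = poly_at p a + poly_at q a"
proof (induction p arbitrary: q)
  case (pCons c p)
  obtain d r where "q = pCons d r" by (rule pCons_cases)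
  then show ?case
    by (simp add: pCons.IH scaleC_add_left algebra_simps)
qed simp

lemma poly_at_smult [simp]: "poly_at (smult c q) a = c *\<^sub>C poly_at q a"
  by (induction q) (simp_all add: scaleC_add_right scaleC_scaleC mult_scaleC_right)

lemma poly_at_minus [simp]: "poly_at (- q) a = - poly_at q a"
  using poly_at_add[of q "-q" a] by (simp add: add_eq_0_iff)

lemma poly_at_diff [simp]: "poly_at (p - q) a = poly_at p a - poly_at q a"
  using poly_at_add[of p "-q" a] by simp

lemma poly_at_mult [simp]: "poly_at (p * q) a = poly_at p a * poly_at q a"
  by (induction p) (simp_all add: mult_pCons_left mult_scaleC_left distrib_right mult.assoc)

lemma poly_at_star: "star (poly_at q a) = poly_at (map_poly cnj q) (star a)"
proof (induction q)
  case (pCons c q)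
  \<comment> \<open>The involution reverses products and puts \<open>star a\<close> on the right of
    the Horner step; it is moved back through commutativity of the polynomial ring.\<close>
  have "star (poly_at q a) * star a = star a * star (poly_at q a)"
    using poly_at_mult[of "map_poly cnj q" "[:0, 1:]" "star a"]
      poly_at_mult[of "[:0, 1:]" "map_poly cnj q" "star a"]
    by (simp add: pCons.IH mult.commute)
  then show ?case
    by (simp add: map_poly_pCons star_add star_mult star_scaleC pCons.IH)
qed simp

lemma poly_map_cnj: "poly (map_poly cnj q) z = cnj (poly q (cnj z))"
  using poly_cnj[of q "cnj z"] by (simp only: complex_cnj_cnj)

text \<open>The polynomial \<open>q - q(z)\<close> is divisible by \<open>X - z\<close>. The two
  factors commute at \<open>a\<close>, so the non-unit \<open>a - z\<close> makes the product a
  non-unit.\<close>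

lemma poly_in_spectrum_poly_at:
  assumes "z \<in> spectrum a"
  shows "poly q z \<in> spectrum (poly_at q a)"
proof -
  have "[:-z, 1:] dvd q - [:poly q z:]"
    by (simp add: poly_eq_0_iff_dvd[symmetric])
  then obtain s where s: "q - [:poly q z:] = [:-z, 1:] * s" by (rule dvdE)
  have fac: "poly_at q a - poly q z *\<^sub>C 1 = (a - z *\<^sub>C 1) * poly_at s a"
    using arg_cong[OF s, of "\<lambda>u. poly_at u a"] by (simp only: poly_at_mult) (simp add: scaleC_minus_left)
  have "(a - z *\<^sub>C 1) * poly_at s a = poly_at s a * (a - z *\<^sub>C 1)"
    using arg_cong[OF mult.commute[of "[:-z, 1:]" s], of "\<lambda>u. poly_at u a"]
    by (simp only: poly_at_mult) (simp add: scaleC_minus_left)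
  then have "\<not> two_sided_unit (poly_at q a - poly q z *\<^sub>C 1)"
    using assms two_sided_unit_commuting_factor[of "a - z *\<^sub>C 1" "poly_at s a"]
    unfolding fac by (auto simp: spectrum_def)
  then show ?thesis by (simp add: spectrum_def)
qed

text \<open>Over the complex numbers \<open>q\<close> splits into linear factors, and one of them
  must be a non-unit at \<open>a\<close>. If \<open>q\<close> is constant it is 0, and any spectral
  point is a root; this is where nonemptiness enters.\<close>

lemma root_in_spectrum:
  assumes "\<not> two_sided_unit (poly_at q a)" "spectrum a \<noteq> {}"
  shows "\<exists>z\<in>spectrum a. poly q z = 0"
  using assms(1)
proof (induction "degree q" arbitrary: q rule: less_induct)
  case less
  show ?case
  proof (cases "degree q = 0")
    case True
    then obtain c where q: "q = [:c:]" by (rule degree_eq_zeroE)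
    then have "c = 0"
      using less.prems two_sided_unit_scaleC[of "1::'a" c] by auto
    then show ?thesis using q assms(2) by auto
  next
    case False
    then obtain r where "poly q r = 0"
      using fundamental_theorem_of_algebra[of q] by (auto simp: constant_degree)
    then obtain s where s: "q = [:-r, 1:] * s"
      by (auto simp: poly_eq_0_iff_dvd)
    have "s \<noteq> 0" using s False by auto
    then have deg: "degree s < degree q" unfolding s by (subst degree_mult_eq) auto
    show ?thesis
    proof (cases "r \<in> spectrum a")
      case True
      then show ?thesis using \<open>poly q r = 0\<close> by blast
    next
      case False
      have "poly_at q a = (a - r *\<^sub>C 1) * poly_at s a"
        unfolding s by (simp only: poly_at_mult) (simp add: scaleC_minus_left)
      then have "\<not> two_sided_unit (poly_at s a)"
        using less.prems False two_sided_unit_mult by (auto simp: spectrum_def)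
      then obtain z where "z \<in> spectrum a" "poly s z = 0"
        using less.hyps[OF deg] by blast
      then show ?thesis by (intro bexI[of _ z]) (simp_all add: s)
    qed
  qed
qed

lemma spectrum_selfadjoint_nonempty: "star a = a \<Longrightarrow> spectrum a \<noteq> {}"
  using spectrum_attains_norm by blast

lemma spectrum_poly_at:
  assumes "spectrum a \<noteq> {}"
  shows "spectrum (poly_at q a) = poly q ` spectrum a"
proof (intro equalityI subsetI)
  fix w assume "w \<in> spectrum (poly_at q a)"
  then have "\<not> two_sided_unit (poly_at (q - [:w:]) a)"
    by (simp add: spectrum_def)
  then obtain z where "z \<in> spectrum a" "poly (q - [:w:]) z = 0"
    using root_in_spectrum assms by blast
  then show "w \<in> poly q ` spectrum a" by (intro image_eqI[of _ _ z]) simp_all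
qed (use poly_in_spectrum_poly_at in auto)

text \<open>\<open>poly_at q a\<close> need not be self-adjoint, so norm attainment is applied to
  its adjoint times itself. This is a polynomial in \<open>a\<close> with value
  \<open>|q(z)|^2\<close> at each \<open>z\<close> of the real set
  \<open>spectrum a\<close>.\<close>

lemma norm_poly_at:
  assumes sa: "star a = a"
  shows "\<exists>z\<in>spectrum a. norm (poly_at q a) = cmod (poly q z)"
    and "z \<in> spectrum a \<Longrightarrow> cmod (poly q z) \<le> norm (poly_at q a)"
proof -
  let ?r = "map_poly cnj q * q"
  have r: "star (poly_at q a) * poly_at q a = poly_at ?r a"
    by (simp add: poly_at_star sa)
  have "star (poly_at ?r a) = poly_at ?r a"
    by (simp only: star_mult star_star r[symmetric])
  then obtain w where w: "w \<in> spectrum (poly_at ?r a)" "cmod w = norm (poly_at ?r a)"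
    using spectrum_attains_norm by blast
  then obtain z where z: "z \<in> spectrum a" "w = poly ?r z"
    using spectrum_poly_at[OF spectrum_selfadjoint_nonempty[OF sa]] by blast
  have "Im z = 0" using spectrum_selfadjoint_real[OF sa z(1)] .
  then have "cnj z = z" by (simp add: complex_eq_iff)
  then have "cmod w = (cmod (poly q z))\<^sup>2"
    using z(2) by (simp add: poly_map_cnj norm_mult power2_eq_square)
  then have "(norm (poly_at q a))\<^sup>2 = (cmod (poly q z))\<^sup>2"
    using w(2) cstar_identity[of "poly_at q a"] r by simp
  then show "\<exists>z\<in>spectrum a. norm (poly_at q a) = cmod (poly q z)"
    using z(1) by (metis norm_ge_zero power2_eq_iff_nonneg)
  show "cmod (poly q z) \<le> norm (poly_at q a)" if "z \<in> spectrum a" for z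
    using spectrum_norm_le poly_in_spectrum_poly_at that by blast
qed

text \<open>The graph of the functional calculus as a relation: its algebraic rules follow from
  limits of polynomials before existence and uniqueness of the value are known.\<close>

definition poly_limit :: "'a::cstar_algebra \<Rightarrow> (complex \<Rightarrow> complex) \<Rightarrow> 'a \<Rightarrow> bool" where
  "poly_limit a f b \<longleftrightarrow> (\<exists>q. uniform_limit (spectrum a) (\<lambda>n. poly (q n)) f sequentially \<and>
     (\<lambda>n. poly_at (q n) a) \<longlonglongrightarrow> b)"

text \<open>Since \<open>S\<close> lies on the real line, real Weierstrass approximation of the real
  and imaginary parts suffices, and polynomials in \<open>z\<close> alone do the work.\<close>

lemma poly_approximation:
  fixes f :: "complex \<Rightarrow> complex"
  assumes S: "compact S" "\<And>z. z \<in> S \<Longrightarrow> Im z = 0" and f: "continuous_on S f" and e: "e > 0"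
  shows "\<exists>q. \<forall>z\<in>S. cmod (f z - poly q z) < e"
proof -
  have cS: "compact (Re ` S)"
    using S(1) by (intro compact_continuous_image continuous_intros)
  have real: "\<exists>q. \<forall>z\<in>S. cmod (of_real (g z) - poly q z) < d"
    if g: "continuous_on S g" and d: "d > 0" for g :: "complex \<Rightarrow> real" and d
  proof -
    have "continuous_on (Re ` S) (\<lambda>x. g (of_real x))"
    proof (rule continuous_on_compose2[OF g])
      have "of_real (Re z) = z" if "z \<in> S" for z
        using S(2)[OF that] by (simp add: complex_eq_iff)
      then show "complex_of_real ` Re ` S \<subseteq> S" by (auto simp: image_image)
    qed (intro continuous_intros)
    then obtain h where h: "real_polynomial_function h" "\<And>x. x \<in> Re ` S \<Longrightarrow> \<bar>g (of_real x) - h x\<bar> < d"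
      using Stone_Weierstrass_real_polynomial_function[OF cS _ d, of "\<lambda>x. g (of_real x)"] by blast
    then obtain c n where h_eq: "h = (\<lambda>x. \<Sum>i\<le>n. c i * x ^ i)"
      using real_polynomial_function_iff_sum by blast
    define q where "q = (\<Sum>i\<le>n. monom (complex_of_real (c i)) i)"
    have "cmod (of_real (g z) - poly q z) < d" if "z \<in> S" for z
    proof -
      have z: "z = of_real (Re z)" using S(2)[OF that] by (simp add: complex_eq_iff)
      have "poly q z = of_real (h (Re z))"
        by (subst z) (simp add: q_def h_eq poly_sum poly_monom)
      then have "cmod (of_real (g z) - poly q z) = \<bar>g (of_real (Re z)) - h (Re z)\<bar>"
        by (metis norm_of_real of_real_diff z)
      then show ?thesis using h(2)[of "Re z"] that by simp
    qed
    then show ?thesis by blast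
  qed
  obtain p where p: "\<And>z. z \<in> S \<Longrightarrow> cmod (of_real (Re (f z)) - poly p z) < e/2"
    using real[of "\<lambda>z. Re (f z)" "e/2"] f e by (auto intro!: continuous_intros)
  obtain q where q: "\<And>z. z \<in> S \<Longrightarrow> cmod (of_real (Im (f z)) - poly q z) < e/2"
    using real[of "\<lambda>z. Im (f z)" "e/2"] f e by (auto intro!: continuous_intros)
  have "cmod (f z - poly (p + smult \<i> q) z) < e" if "z \<in> S" for z
  proof -
    have "f z - poly (p + smult \<i> q) z =
        (of_real (Re (f z)) - poly p z) + \<i> * (of_real (Im (f z)) - poly q z)"
      by (subst complex_eq[of "f z"]) (simp add: algebra_simps)
    also have "cmod \<dots> \<le> cmod (of_real (Re (f z)) - poly p z) + cmod (of_real (Im (f z)) - poly q z)"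
      by (rule norm_triangle_le) (simp add: norm_mult)
    also have "\<dots> < e" using p[OF that] q[OF that] by simp
    finally show ?thesis .
  qed
  then show ?thesis by blast
qed

text \<open>By the isometry \<open>norm_poly_at\<close>, polynomials converging uniformly on the
  spectrum give a Cauchy sequence in the algebra.\<close>

lemma poly_limit_exists:
  assumes sa: "star a = a" and f: "continuous_on (spectrum a) f"
  shows "\<exists>b. poly_limit a f b"
proof -
  have "\<forall>n. \<exists>q. \<forall>z\<in>spectrum a. cmod (f z - poly q z) < inverse (real (Suc n))"
    using poly_approximation[OF compact_spectrum _ f] spectrum_selfadjoint_real[OF sa] by auto
  then obtain q where q: "\<And>n z. z \<in> spectrum a \<Longrightarrow> cmod (f z - poly (q n) z) < inverse (real (Suc n))"
    by metis
  have unif: "uniform_limit (spectrum a) (\<lambda>n. poly (q n)) f sequentially"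
  proof (rule uniform_limitI)
    fix e :: real assume "e > 0"
    then have "\<forall>\<^sub>F n in sequentially. inverse (real (Suc n)) < e"
      using LIMSEQ_inverse_real_of_nat order_tendstoD(2) by blast
    then show "\<forall>\<^sub>F n in sequentially. \<forall>z\<in>spectrum a. dist (poly (q n) z) (f z) < e"
      by eventually_elim (metis q dist_norm norm_minus_commute order_less_trans)
  qed
  have "Cauchy (\<lambda>n. poly_at (q n) a)"
  proof (rule metric_CauchyI)
    fix e :: real assume "e > 0"
    then have "uniformly_Cauchy_on (spectrum a) (\<lambda>n. poly (q n))"
      using unif uniformly_convergent_Cauchy uniformly_convergent_on_def by blast
    then obtain M where M: "\<And>z m n. z \<in> spectrum a \<Longrightarrow> m \<ge> M \<Longrightarrow> n \<ge> M \<Longrightarrow> dist (poly (q m) z) (poly (q n) z) < e"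
      using \<open>e > 0\<close> unfolding uniformly_Cauchy_on_def by blast
    have "dist (poly_at (q m) a) (poly_at (q n) a) < e" if "m \<ge> M" "n \<ge> M" for m n
      using norm_poly_at(1)[OF sa, of "q m - q n"] M that by (auto simp: dist_norm)
    then show "\<exists>M. \<forall>m\<ge>M. \<forall>n\<ge>M. dist (poly_at (q m) a) (poly_at (q n) a) < e" by blast
  qed
  then show ?thesis
    using unif unfolding poly_limit_def Cauchy_convergent_iff convergent_def by blast
qed

lemma poly_limit_continuous:
  assumes "poly_limit a f b"
  shows "continuous_on (spectrum a) f"
proof -
  obtain q where "uniform_limit (spectrum a) (\<lambda>n. poly (q n)) f sequentially"
    using assms unfolding poly_limit_def by blast
  moreover have "continuous_on (spectrum a) (poly (q n))" for n
    using continuous_on_poly[OF continuous_on_id, of "spectrum a" "q n"] by simp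
  ultimately show ?thesis
    by (intro uniform_limit_theorem[where F = sequentially]) simp_all
qed

lemma poly_limit_add: "poly_limit a f b \<Longrightarrow> poly_limit a g c \<Longrightarrow> poly_limit a (\<lambda>z. f z + g z) (b + c)"
proof -
  assume "poly_limit a f b" "poly_limit a g c"
  then obtain p q where
    "uniform_limit (spectrum a) (\<lambda>n. poly (p n)) f sequentially" "(\<lambda>n. poly_at (p n) a) \<longlonglongrightarrow> b"
    "uniform_limit (spectrum a) (\<lambda>n. poly (q n)) g sequentially" "(\<lambda>n. poly_at (q n) a) \<longlonglongrightarrow> c"
    unfolding poly_limit_def by blast
  then show ?thesis unfolding poly_limit_def
    by (intro exI[of _ "\<lambda>n. p n + q n"]) (auto intro: uniform_limit_add tendsto_add simp: poly_add[abs_def])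
qed

lemma poly_limit_mult: "poly_limit a f b \<Longrightarrow> poly_limit a g c \<Longrightarrow> poly_limit a (\<lambda>z. f z * g z) (b * c)"
proof -
  assume lim: "poly_limit a f b" "poly_limit a g c"
  then obtain p q where
    "uniform_limit (spectrum a) (\<lambda>n. poly (p n)) f sequentially" "(\<lambda>n. poly_at (p n) a) \<longlonglongrightarrow> b"
    "uniform_limit (spectrum a) (\<lambda>n. poly (q n)) g sequentially" "(\<lambda>n. poly_at (q n) a) \<longlonglongrightarrow> c"
    unfolding poly_limit_def by blast
  moreover have "bounded (f ` spectrum a)" "bounded (g ` spectrum a)"
    using lim by (auto intro!: compact_imp_bounded compact_continuous_image compact_spectrum
        dest: poly_limit_continuous)
  ultimately show ?thesis unfolding poly_limit_def
    by (intro exI[of _ "\<lambda>n. p n * q n"]) (auto intro!: uniform_lim_mult tendsto_mult simp: poly_mult[abs_def])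
qed

lemma poly_limit_poly: "poly_limit a (poly q) (poly_at q a)"
  unfolding poly_limit_def by (intro exI[of _ "\<lambda>_. q"]) (auto simp: uniform_limit_const)

lemma poly_limit_cong:
  assumes "poly_limit a f b" "\<And>z. z \<in> spectrum a \<Longrightarrow> f z = g z"
  shows "poly_limit a g b"
  using assms unfolding poly_limit_def by (metis (no_types, lifting) uniform_limit_cong')

lemma poly_limit_const: "poly_limit a (\<lambda>_. c) (c *\<^sub>C 1)"
  using poly_limit_cong[OF poly_limit_poly[of a "[:c:]"], of "\<lambda>_. c"] by simp

lemma poly_limit_id: "poly_limit a (\<lambda>z. z) a"
  using poly_limit_cong[OF poly_limit_poly[of a "[:0, 1:]"], of "\<lambda>z. z"] by simp

lemma poly_limit_star:
  assumes "star a = a" "poly_limit a f b"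
  shows "poly_limit a (\<lambda>z. cnj (f z)) (star b)"
proof -
  obtain q where q: "uniform_limit (spectrum a) (\<lambda>n. poly (q n)) f sequentially" "(\<lambda>n. poly_at (q n) a) \<longlonglongrightarrow> b"
    using assms(2) unfolding poly_limit_def by blast
  have "dist (poly (map_poly cnj (q n)) z) (cnj (f z)) = dist (poly (q n) z) (f z)" if "z \<in> spectrum a" for n z
  proof -
    have "cnj z = z"
      using spectrum_selfadjoint_real[OF assms(1) that] by (simp add: complex_eq_iff)
    then show ?thesis
      by (simp add: poly_map_cnj dist_norm flip: complex_cnj_diff)
  qed
  then have "uniform_limit (spectrum a) (\<lambda>n. poly (map_poly cnj (q n))) (\<lambda>z. cnj (f z)) sequentially"
    using q(1) unfolding uniform_limit_iff by simp
  moreover have "(\<lambda>n. poly_at (map_poly cnj (q n)) a) \<longlonglongrightarrow> star b"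
    using tendsto_star[OF q(2)] by (simp add: poly_at_star assms(1))
  ultimately show ?thesis unfolding poly_limit_def by (intro exI[of _ "\<lambda>n. map_poly cnj (q n)"]) auto
qed

lemma poly_limit_norm_ge:
  assumes "star a = a" "poly_limit a f b" "z \<in> spectrum a"
  shows "cmod (f z) \<le> norm b"
proof -
  obtain q where q: "uniform_limit (spectrum a) (\<lambda>n. poly (q n)) f sequentially" "(\<lambda>n. poly_at (q n) a) \<longlonglongrightarrow> b"
    using assms(2) unfolding poly_limit_def by blast
  show ?thesis
    using tendsto_uniform_limitI[OF q(1) assms(3)] q(2) norm_poly_at(2)[OF assms(1,3)]
    by (intro tendsto_le[OF _ tendsto_norm tendsto_norm]) auto
qed

lemma poly_limit_norm_le:
  assumes "star a = a" "poly_limit a f b" "\<And>z. z \<in> spectrum a \<Longrightarrow> cmod (f z) \<le> M"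
  shows "norm b \<le> M"
proof (rule field_le_epsilon)
  fix e :: real assume e: "e > 0"
  obtain q where q: "uniform_limit (spectrum a) (\<lambda>n. poly (q n)) f sequentially" "(\<lambda>n. poly_at (q n) a) \<longlonglongrightarrow> b"
    using assms(2) unfolding poly_limit_def by blast
  have "\<forall>\<^sub>F n in sequentially. norm (poly_at (q n) a) \<le> M + e"
    using uniform_limitD[OF q(1) e]
  proof eventually_elim
    case (elim n)
    obtain z where z: "z \<in> spectrum a" "norm (poly_at (q n) a) = cmod (poly (q n) z)"
      using norm_poly_at(1)[OF assms(1)] by blast
    show ?case
      using elim z assms(3)[OF z(1)] norm_triangle_ineq2[of "poly (q n) z" "f z"]
      by (force simp: dist_norm)
  qed
  then show "norm b \<le> M + e"
    using tendsto_upperbound[OF tendsto_norm[OF q(2)]] by simp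
qed

text \<open>Subtracting the two limits gives a limit for the zero function, whose norm is at most
  0.\<close>

lemma poly_limit_unique:
  assumes "star a = a" "poly_limit a f b" "poly_limit a f c"
  shows "b = c"
proof -
  have "poly_limit a (\<lambda>z. f z + (-1) * f z) (b + ((-1) *\<^sub>C 1) * c)"
    by (intro poly_limit_add poly_limit_mult poly_limit_const assms)
  then have "norm (b - c) \<le> 0"
    using poly_limit_norm_le[OF assms(1), of "\<lambda>z. f z + (-1) * f z" "b - c" 0]
    by (simp add: mult_scaleC_left scaleC_minus_left)
  then show ?thesis by simp
qed

lemma norm_eq_SUP_spectrum:
  assumes "star a = a" "poly_limit a f b"
  shows "norm b = (SUP z\<in>spectrum a. cmod (f z))"
proof (rule antisym)
  have ge: "cmod (f z) \<le> norm b" if "z \<in> spectrum a" for z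
    using poly_limit_norm_ge[OF assms that] .
  then have "bdd_above ((\<lambda>z. cmod (f z)) ` spectrum a)" by (intro bdd_aboveI2)
  then show "norm b \<le> (SUP z\<in>spectrum a. cmod (f z))"
    by (intro poly_limit_norm_le[OF assms] cSUP_upper)
  show "(SUP z\<in>spectrum a. cmod (f z)) \<le> norm b"
    using spectrum_selfadjoint_nonempty[OF assms(1)] ge by (intro cSUP_least)
qed

text \<open>The axioms force \<open>F\<close> to be \<open>poly_at\<close> on polynomials, and the
  isometry axiom carries this to uniform limits. Hence all functional calculi for \<open>a\<close>
  agree on continuous functions and \<open>cfc\<close> is well defined there.\<close>

lemma functional_calculus_poly_limit:
  assumes F: "is_functional_calculus a F" and sa: "star a = a" and f: "continuous_on (spectrum a) f"
  shows "poly_limit a f (F f)"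
proof -
  have Fadd: "F (\<lambda>z. g z + h z) = F g + F h"
    if "continuous_on (spectrum a) g" "continuous_on (spectrum a) h" for g h
    using F that unfolding is_functional_calculus_def Let_def by blast
  have Fmult: "F (\<lambda>z. g z * h z) = F g * F h"
    if "continuous_on (spectrum a) g" "continuous_on (spectrum a) h" for g h
    using F that unfolding is_functional_calculus_def Let_def by blast
  have Fscale: "F (\<lambda>z. c * g z) = c *\<^sub>C F g" if "continuous_on (spectrum a) g" for g c
    using F that unfolding is_functional_calculus_def Let_def by blast
  have Fnorm: "norm (F g) = (SUP z\<in>spectrum a. cmod (g z))" if "continuous_on (spectrum a) g" for g
    using F that unfolding is_functional_calculus_def Let_def by blast
  have F1: "F (\<lambda>z. 1) = 1" and Fid: "F (\<lambda>z. z) = a"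
    using F unfolding is_functional_calculus_def Let_def by blast+
  have Fpoly: "F (poly q) = poly_at q a" for q
  proof (induction q)
    case 0
    show ?case using Fscale[of "\<lambda>_. 1" 0] F1 by (simp add: poly_0)
  next
    case (pCons c q)
    have "F (poly (pCons c q)) = F (\<lambda>z. c * 1 + z * poly q z)"
      by (rule arg_cong[of _ _ F]) (simp add: fun_eq_iff)
    also have "\<dots> = c *\<^sub>C 1 + a * F (poly q)"
      by (subst Fadd Fscale Fmult, (intro continuous_intros)+)+ (simp add: F1 Fid)
    finally show ?case by (simp only: pCons.IH poly_at_pCons)
  qed
  obtain b where b: "poly_limit a f b" using poly_limit_exists[OF sa f] by blast
  then obtain q where q: "uniform_limit (spectrum a) (\<lambda>n. poly (q n)) f sequentially"
      "(\<lambda>n. poly_at (q n) a) \<longlonglongrightarrow> b"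
    unfolding poly_limit_def by blast
  have "(\<lambda>n. poly_at (q n) a) \<longlonglongrightarrow> F f"
  proof (rule tendstoI)
    fix e :: real assume "e > 0"
    then have "e / 2 > 0" by simp
    show "\<forall>\<^sub>F n in sequentially. dist (poly_at (q n) a) (F f) < e"
      using uniform_limitD[OF q(1) \<open>e / 2 > 0\<close>]
    proof eventually_elim
      case (elim n)
      have "poly_at (q n) a - F f = F (poly (q n)) + (-1) *\<^sub>C F f"
        by (simp add: Fpoly scaleC_minus_left)
      also have "\<dots> = F (\<lambda>z. poly (q n) z + (-1) * f z)"
        by (subst Fadd Fscale, (intro continuous_intros f)+)+ simp
      also have "norm \<dots> = (SUP z\<in>spectrum a. cmod (poly (q n) z + (-1) * f z))"
        by (intro Fnorm continuous_intros f)
      also have "\<dots> \<le> e / 2"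
        using elim spectrum_selfadjoint_nonempty[OF sa]
        by (intro cSUP_least) (auto simp: dist_norm less_imp_le)
      finally show ?case using \<open>e > 0\<close> by (simp add: dist_norm)
    qed
  qed
  then show ?thesis using b LIMSEQ_unique q(2) by blast
qed

lemma is_functional_calculus_exists:
  assumes sa: "star a = a"
  shows "is_functional_calculus a (\<lambda>f. THE b. poly_limit a f b)"
proof -
  let ?F = "\<lambda>f. THE b. poly_limit a f b"
  have eq: "?F f = b" if "poly_limit a f b" for f b
    using that poly_limit_unique[OF sa] by blast
  have lim: "poly_limit a f (?F f)" if "continuous_on (spectrum a) f" for f
    using poly_limit_exists[OF sa that] eq by metis
  have 1: "?F f = ?F g" if "continuous_on (spectrum a) f" "\<forall>z\<in>spectrum a. f z = g z" for f g
    using poly_limit_cong[OF lim[OF that(1)]] that(2) eq[of g "?F f"] by auto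
  have 2: "?F (\<lambda>z. c * f z) = c *\<^sub>C ?F f" if "continuous_on (spectrum a) f" for f c
    using eq[OF poly_limit_mult[OF poly_limit_const lim[OF that]], of c] by (simp add: mult_scaleC_left)
  have 3: "?F (\<lambda>z. 1) = 1"
    using eq[OF poly_limit_const[of a 1]] by simp
  show ?thesis
    unfolding is_functional_calculus_def Let_def mem_Collect_eq
    by (intro conjI ballI allI impI)
      (simp_all only: mem_Collect_eq 1 2 3 eq[OF poly_limit_add[OF lim lim]] eq[OF poly_limit_mult[OF lim lim]]
        eq[OF poly_limit_star[OF sa lim]] norm_eq_SUP_spectrum[OF sa lim] eq[OF poly_limit_id[of a]])
qed

lemma cfc_unique:
  assumes sa: "star a = a" and f: "continuous_on (spectrum a) f" and F: "is_functional_calculus a F"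
  shows "cfc f a = F f"
  unfolding cfc_def
proof (rule the_equality)
  fix b assume "\<exists>F. is_functional_calculus a F \<and> F f = b"
  then obtain G where G: "is_functional_calculus a G" "G f = b" by auto
  show "b = F f"
    using poly_limit_unique[OF sa functional_calculus_poly_limit[OF G(1) sa f]
        functional_calculus_poly_limit[OF F sa f]] G(2) by simp
qed (intro exI[of _ F] conjI F refl)

lemma poly_limit_cfc:
  assumes "star a = a" "continuous_on (spectrum a) f"
  shows "poly_limit a f (cfc f a)"
  using cfc_unique[OF assms is_functional_calculus_exists[OF assms(1)]]
    functional_calculus_poly_limit[OF is_functional_calculus_exists[OF assms(1)] assms] by simp

lemma cfc_eqI:
  assumes "star a = a" "poly_limit a f b"
  shows "cfc f a = b"
  by (rule poly_limit_unique[OF assms(1) poly_limit_cfc[OF assms(1) poly_limit_continuous[OF assms(2)]] assms(2)])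

section \<open>Calculation rules for the functional calculus\<close>

context
  fixes a :: "'a::cstar_algebra"
  assumes sa: "star a = a"
begin

lemma cfc_cong:
  assumes "continuous_on (spectrum a) f" "\<And>z. z \<in> spectrum a \<Longrightarrow> f z = g z"
  shows "cfc f a = cfc g a"
  using cfc_eqI[OF sa poly_limit_cong[OF poly_limit_cfc[OF sa assms(1)] assms(2)]] by simp

lemma cfc_const [simp]: "cfc (\<lambda>_. c) a = c *\<^sub>C 1"
  by (rule cfc_eqI[OF sa poly_limit_const])

lemma cfc_id [simp]: "cfc (\<lambda>z. z) a = a"
  by (rule cfc_eqI[OF sa poly_limit_id])

lemma cfc_add:
  "continuous_on (spectrum a) f \<Longrightarrow> continuous_on (spectrum a) g \<Longrightarrow>
     cfc (\<lambda>z. f z + g z) a = cfc f a + cfc g a"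
  by (intro cfc_eqI sa poly_limit_add poly_limit_cfc)

lemma cfc_mult:
  "continuous_on (spectrum a) f \<Longrightarrow> continuous_on (spectrum a) g \<Longrightarrow>
     cfc (\<lambda>z. f z * g z) a = cfc f a * cfc g a"
  by (intro cfc_eqI sa poly_limit_mult poly_limit_cfc)

lemma cfc_scale:
  "continuous_on (spectrum a) f \<Longrightarrow> cfc (\<lambda>z. c * f z) a = c *\<^sub>C cfc f a"
  by (simp add: cfc_mult mult_scaleC_left)

lemma cfc_minus: "continuous_on (spectrum a) f \<Longrightarrow> cfc (\<lambda>z. - f z) a = - cfc f a"
  using cfc_scale[of f "-1"] by (simp add: scaleC_minus_left)

lemma cfc_diff:
  "continuous_on (spectrum a) f \<Longrightarrow> continuous_on (spectrum a) g \<Longrightarrow>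
     cfc (\<lambda>z. f z - g z) a = cfc f a - cfc g a"
  using cfc_add[of f "\<lambda>z. - g z"] by (simp add: cfc_minus continuous_on_minus)

lemma cfc_sum:
  "(\<And>i. i \<in> I \<Longrightarrow> continuous_on (spectrum a) (f i)) \<Longrightarrow>
     cfc (\<lambda>z. \<Sum>i\<in>I. f i z) a = (\<Sum>i\<in>I. cfc (f i) a)"
  by (induction I rule: infinite_finite_induct) (simp_all add: cfc_add continuous_on_sum)

lemma cfc_star: "continuous_on (spectrum a) f \<Longrightarrow> cfc (\<lambda>z. cnj (f z)) a = star (cfc f a)"
  by (intro cfc_eqI sa poly_limit_star poly_limit_cfc)

lemma cfc_selfadjoint:
  assumes "continuous_on (spectrum a) f" "\<And>z. z \<in> spectrum a \<Longrightarrow> Im (f z) = 0"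
  shows "star (cfc f a) = cfc f a"
proof -
  have "cfc f a = cfc (\<lambda>z. cnj (f z)) a"
    using assms by (intro cfc_cong) (auto simp: complex_eq_iff)
  then show ?thesis using cfc_star[OF assms(1)] by simp
qed

lemma norm_cfc: "continuous_on (spectrum a) f \<Longrightarrow> norm (cfc f a) = (SUP z\<in>spectrum a. cmod (f z))"
  by (rule norm_eq_SUP_spectrum[OF sa poly_limit_cfc[OF sa]])

lemma norm_cfc_le:
  "continuous_on (spectrum a) f \<Longrightarrow> (\<And>z. z \<in> spectrum a \<Longrightarrow> cmod (f z) \<le> M) \<Longrightarrow> norm (cfc f a) \<le> M"
  by (rule poly_limit_norm_le[OF sa poly_limit_cfc[OF sa]])

lemma norm_cfc_ge: "continuous_on (spectrum a) f \<Longrightarrow> z \<in> spectrum a \<Longrightarrow> cmod (f z) \<le> norm (cfc f a)"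
  by (rule poly_limit_norm_ge[OF sa poly_limit_cfc[OF sa]])

text \<open>Off the image of \<open>f\<close>, the function \<open>1 / (f - w)\<close> is continuous
  and supplies an inverse. On the image, \<open>cfc f a - f(z)\<close> is a limit of polynomial
  non-units, and the non-units form a closed set.\<close>

lemma spectrum_cfc:
  assumes f: "continuous_on (spectrum a) f"
  shows "spectrum (cfc f a) = f ` spectrum a"
proof (intro equalityI subsetI)
  fix w assume w: "w \<in> spectrum (cfc f a)"
  show "w \<in> f ` spectrum a"
  proof (rule ccontr)
    assume "w \<notin> f ` spectrum a"
    then have nz: "\<And>z. z \<in> spectrum a \<Longrightarrow> f z - w \<noteq> 0" by auto
    have c: "continuous_on (spectrum a) (\<lambda>z. f z - w)" "continuous_on (spectrum a) (\<lambda>z. inverse (f z - w))"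
      using nz f by (auto intro!: continuous_intros)
    have "cfc (\<lambda>z. f z - w) a = cfc f a - w *\<^sub>C 1"
      using f by (subst cfc_diff) auto
    moreover have "cfc (\<lambda>z. (f z - w) * inverse (f z - w)) a = 1"
      "cfc (\<lambda>z. inverse (f z - w) * (f z - w)) a = 1"
      using cfc_cong[of "\<lambda>z. (f z - w) * inverse (f z - w)" "\<lambda>_. 1"]
        cfc_cong[of "\<lambda>z. inverse (f z - w) * (f z - w)" "\<lambda>_. 1"] c nz
      by (simp_all add: continuous_on_mult)
    ultimately have "two_sided_unit (cfc f a - w *\<^sub>C 1)"
      using c unfolding two_sided_unit_def
      by (intro exI[of _ "cfc (\<lambda>z. inverse (f z - w)) a"]) (simp add: cfc_mult)
    then show False using w by (simp add: spectrum_def)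
  qed
next
  fix w assume "w \<in> f ` spectrum a"
  then obtain z where z: "z \<in> spectrum a" "w = f z" by blast
  obtain q where q: "uniform_limit (spectrum a) (\<lambda>n. poly (q n)) f sequentially"
      "(\<lambda>n. poly_at (q n) a) \<longlonglongrightarrow> cfc f a"
    using poly_limit_cfc[OF sa f] unfolding poly_limit_def by blast
  have lim: "(\<lambda>n. poly_at (q n) a - poly (q n) z *\<^sub>C 1) \<longlonglongrightarrow> cfc f a - w *\<^sub>C 1"
    unfolding z(2) by (intro tendsto_intros q(2) tendsto_uniform_limitI[OF q(1) z(1)])
  have closed: "closed (- {b::'a. two_sided_unit b})"
    using open_two_sided_unit by blast
  have nonunit: "poly_at (q n) a - poly (q n) z *\<^sub>C 1 \<in> - {b. two_sided_unit b}" for n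
    using poly_in_spectrum_poly_at[OF z(1)] by (auto simp: spectrum_def)
  have "cfc f a - w *\<^sub>C 1 \<in> - {b. two_sided_unit b}"
    using closed_sequentially[OF closed nonunit lim] .
  then show "w \<in> spectrum (cfc f a)" by (simp add: spectrum_def)
qed

text \<open>The map sending \<open>g\<close> to the value of \<open>g o f\<close> at
  \<open>a\<close> satisfies the axioms of a functional calculus for \<open>cfc f a\<close>, so
  uniqueness applies. Real values of \<open>f\<close> make \<open>cfc f a\<close>
  self-adjoint.\<close>

lemma cfc_compose:
  assumes f: "continuous_on (spectrum a) f" and real: "\<And>z. z \<in> spectrum a \<Longrightarrow> Im (f z) = 0"
    and g: "continuous_on (f ` spectrum a) g"
  shows "cfc g (cfc f a) = cfc (\<lambda>z. g (f z)) a"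
proof (rule cfc_unique[of "cfc f a" g "\<lambda>g. cfc (\<lambda>z. g (f z)) a"])
  show "star (cfc f a) = cfc f a" using cfc_selfadjoint[OF f real] .
  show "continuous_on (spectrum (cfc f a)) g" using g by (simp add: spectrum_cfc[OF f])
  have c: "continuous_on (spectrum a) (\<lambda>z. h (f z))" if "continuous_on (f ` spectrum a) h" for h :: "complex \<Rightarrow> complex"
    using that f by (rule continuous_on_compose2) auto
  show "is_functional_calculus (cfc f a) (\<lambda>g. cfc (\<lambda>z. g (f z)) a)"
    unfolding is_functional_calculus_def Let_def
    by (auto simp: spectrum_cfc[OF f] image_image cfc_add cfc_mult cfc_scale cfc_star norm_cfc c mult_scaleC_left
        intro!: cfc_cong)
qed

end

section \<open>The positive cone and real powers\<close>

lemma spectrum_diff_scalar: "z \<in> spectrum (a - r *\<^sub>R 1) \<longleftrightarrow> z + of_real r \<in> spectrum (a::'a::cstar_algebra)"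
  by (simp add: spectrum_def scaleR_scaleC scaleC_add_left algebra_simps)

lemma positive_cone_selfadjoint: "a \<in> positive_cone \<Longrightarrow> star a = a"
  by (simp add: positive_cone_def)

lemma positive_cone_iff: "star a = a \<Longrightarrow> a \<in> positive_cone \<longleftrightarrow> (\<forall>z\<in>spectrum a. 0 \<le> Re z)"
  using spectrum_selfadjoint_real by (fastforce simp: positive_cone_def complex_nonneg_Reals_iff)

lemma positive_definite_cone_subset: "positive_definite_cone \<subseteq> positive_cone"
  by (auto simp: positive_definite_cone_def)

lemma positive_definite_cone_selfadjoint: "a \<in> positive_definite_cone \<Longrightarrow> star a = a"
  by (simp add: positive_definite_cone_def positive_cone_def)

lemma two_sided_unit_iff_spectrum: "two_sided_unit a \<longleftrightarrow> 0 \<notin> spectrum a"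
  by (simp add: spectrum_def)

lemma positive_definite_cone_iff:
  assumes "star a = a"
  shows "a \<in> positive_definite_cone \<longleftrightarrow> (\<forall>z\<in>spectrum a. 0 < Re z)"
proof
  assume a: "a \<in> positive_definite_cone"
  show "\<forall>z\<in>spectrum a. 0 < Re z"
  proof
    fix z assume z: "z \<in> spectrum a"
    then have "0 \<le> Re z" "z \<noteq> 0"
      using a positive_cone_iff[OF assms] by (auto simp: positive_definite_cone_def two_sided_unit_iff_spectrum)
    then show "0 < Re z"
      using spectrum_selfadjoint_real[OF assms z] by (auto simp: complex_eq_iff order_less_le)
  qed
next
  assume "\<forall>z\<in>spectrum a. 0 < Re z"
  then show "a \<in> positive_definite_cone"
    using positive_cone_iff[OF assms] by (force simp: positive_definite_cone_def two_sided_unit_iff_spectrum)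
qed

lemma spectrum_selfadjoint_of_real: "star a = a \<Longrightarrow> z \<in> spectrum a \<Longrightarrow> z = of_real (Re z)"
  using spectrum_selfadjoint_real by (simp add: complex_eq_iff)

text \<open>A real number \<open>x \<le> t\<close> with \<open>|x| \<le> t\<close> satisfies
  \<open>|t - x| \<le> t\<close> exactly if it is nonnegative. Expressing positivity as a norm
  inequality makes stability under sums and limits accessible.\<close>

lemma positive_cone_iff_norm:
  assumes sa: "star a = a" and t: "norm a \<le> t"
  shows "a \<in> positive_cone \<longleftrightarrow> norm (t *\<^sub>R 1 - a) \<le> t"
proof -
  have c: "continuous_on (spectrum a) (\<lambda>z. of_real t - z)" by (intro continuous_intros)
  have eq: "cfc (\<lambda>z. of_real t - z) a = t *\<^sub>R 1 - a"
    by (subst cfc_diff) (auto simp: sa scaleR_scaleC)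
  have m: "cmod (of_real t - z) = \<bar>t - Re z\<bar>" "Re z \<le> t" if z: "z \<in> spectrum a" for z
  proof -
    show "cmod (of_real t - z) = \<bar>t - Re z\<bar>"
      by (subst spectrum_selfadjoint_of_real[OF sa z], subst of_real_diff[symmetric], rule norm_of_real)
    show "Re z \<le> t"
      using spectrum_norm_le[OF z] t complex_Re_le_cmod[of z] by linarith
  qed
  show ?thesis
  proof
    assume "a \<in> positive_cone"
    then have "norm (cfc (\<lambda>z. of_real t - z) a) \<le> t"
      using m positive_cone_iff[OF sa] by (intro norm_cfc_le[OF sa c]) fastforce
    then show "norm (t *\<^sub>R 1 - a) \<le> t" by (simp add: eq)
  next
    assume le: "norm (t *\<^sub>R 1 - a) \<le> t"
    have "0 \<le> Re z" if "z \<in> spectrum a" for z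
      using norm_cfc_ge[OF sa c that] m[OF that] le by (simp add: eq)
    then show "a \<in> positive_cone" by (simp add: positive_cone_iff[OF sa])
  qed
qed

lemma positive_cone_add:
  assumes "a \<in> positive_cone" "b \<in> positive_cone"
  shows "a + b \<in> positive_cone"
proof -
  have sa: "star a = a" "star b = b" using assms positive_cone_selfadjoint by auto
  have "norm (norm a *\<^sub>R 1 - a) \<le> norm a" "norm (norm b *\<^sub>R 1 - b) \<le> norm b"
    using assms sa positive_cone_iff_norm by blast+
  then have "norm ((norm a + norm b) *\<^sub>R 1 - (a + b)) \<le> norm a + norm b"
    using norm_triangle_ineq[of "norm a *\<^sub>R 1 - a" "norm b *\<^sub>R 1 - b"] by (simp add: algebra_simps)
  then show ?thesis
    using positive_cone_iff_norm[of "a + b" "norm a + norm b"] sa norm_triangle_ineq[of a b]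
    by (simp add: star_add)
qed

lemma positive_cone_closed:
  fixes x :: "nat \<Rightarrow> 'a::cstar_algebra"
  assumes x: "\<And>n. x n \<in> positive_cone" and lim: "x \<longlonglongrightarrow> l"
  shows "l \<in> positive_cone"
proof -
  have sa: "star (x n) = x n" for n using x positive_cone_selfadjoint by blast
  have "(\<lambda>n. star (x n)) \<longlonglongrightarrow> star l" by (intro tendsto_intros lim)
  then have sl: "star l = l" using lim LIMSEQ_unique by (auto simp: sa)
  \<comment> \<open>One bound for the whole sequence also bounds the limit, so the same
    \<open>t\<close> serves in the norm criterion throughout.\<close>
  obtain t where t: "\<And>n. norm (x n) \<le> t"
    using convergent_imp_Bseq[of x] lim unfolding convergent_def Bseq_def by blast
  have "norm l \<le> t"
    using tendsto_upperbound[OF tendsto_norm[OF lim]] t by simp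
  moreover have "norm (t *\<^sub>R 1 - l) \<le> t"
  proof (rule tendsto_upperbound)
    show "(\<lambda>n. norm (t *\<^sub>R 1 - x n)) \<longlonglongrightarrow> norm (t *\<^sub>R 1 - l)" by (intro tendsto_intros lim)
    show "\<forall>\<^sub>F n in sequentially. norm (t *\<^sub>R 1 - x n) \<le> t"
      using positive_cone_iff_norm[OF sa t] x by simp
  qed simp
  ultimately show ?thesis using positive_cone_iff_norm[OF sl] by blast
qed

lemma cfc_positive:
  assumes "star a = a" "continuous_on (spectrum a) f"
    "\<And>z. z \<in> spectrum a \<Longrightarrow> Im (f z) = 0 \<and> 0 \<le> Re (f z)"
  shows "cfc f a \<in> positive_cone"
  using assms by (subst positive_cone_iff) (auto simp: cfc_selfadjoint spectrum_cfc)

lemma positive_cone_scaleR: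
  assumes "a \<in> positive_cone" "r \<ge> 0"
  shows "r *\<^sub>R a \<in> positive_cone"
proof -
  have sa: "star a = a" using assms positive_cone_selfadjoint by blast
  have "cfc (\<lambda>z. of_real r * z) a \<in> positive_cone"
    using assms positive_cone_iff[OF sa] spectrum_selfadjoint_real[OF sa]
    by (intro cfc_positive sa continuous_intros) auto
  then show ?thesis by (simp add: cfc_scale[OF sa] cfc_id[OF sa] scaleR_scaleC)
qed

lemma positive_cone_zero: "0 \<in> positive_cone"
  by (subst positive_cone_iff_norm[of 0 0]) auto

lemma positive_cone_one: "1 \<in> positive_cone"
  by (subst positive_cone_iff_norm[of 1 1]) auto

lemma positive_cone_sum: "(\<And>i. i \<in> I \<Longrightarrow> f i \<in> positive_cone) \<Longrightarrow> sum f I \<in> positive_cone"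
  by (induction I rule: infinite_finite_induct) (auto simp: positive_cone_zero positive_cone_add)

lemma spectrum_minus: "z \<in> spectrum (- a) \<longleftrightarrow> - z \<in> spectrum (a::'a::cstar_algebra)"
proof -
  have "- a - z *\<^sub>C 1 = (-1) *\<^sub>C (a - (- z) *\<^sub>C 1)"
    by (simp add: scaleC_diff_right scaleC_minus_left)
  then show ?thesis
    using two_sided_unit_scaleC_iff[of "-1" "a - (- z) *\<^sub>C 1"] by (simp add: spectrum_def)
qed

lemma positive_cone_antisym:
  assumes "a \<in> positive_cone" "- a \<in> positive_cone"
  shows "a = 0"
proof -
  have sa: "star a = a" using assms positive_cone_selfadjoint by blast
  obtain z where z: "z \<in> spectrum a" "cmod z = norm a" using spectrum_attains_norm[OF sa] by blast
  have "0 \<le> Re z" using assms(1) z positive_cone_iff[OF sa] by blast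
  moreover have "- z \<in> spectrum (- a)" using z(1) by (simp add: spectrum_minus)
  then have "0 \<le> Re (- z)"
    using assms(2) positive_cone_iff[OF positive_cone_selfadjoint[OF assms(2)]] by blast
  ultimately have "z = 0" using spectrum_selfadjoint_real[OF sa z(1)] by (simp add: complex_eq_iff)
  then show ?thesis using z by simp
qed

lemma norm_minus_selfadjoint_positive:
  assumes sa: "star a = a" and r: "norm a \<le> r"
  shows "r *\<^sub>R 1 - a \<in> positive_cone"
proof (subst positive_cone_iff)
  show "star (r *\<^sub>R 1 - a) = r *\<^sub>R 1 - a" using sa by (simp add: star_diff star_scaleR)
  have "0 \<le> Re z" if z: "z \<in> spectrum (r *\<^sub>R 1 - a)" for z
  proof -
    have "of_real r - z \<in> spectrum a"
      using spectrum_diff_scalar[of "-z" a r] spectrum_minus[of z "a - r *\<^sub>R 1"] z by simp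
    then have "Re (of_real r - z) \<le> r"
      using spectrum_norm_le[of "of_real r - z" a] complex_Re_le_cmod[of "of_real r - z"] r by linarith
    then show ?thesis by simp
  qed
  then show "\<forall>z\<in>spectrum (r *\<^sub>R 1 - a). 0 \<le> Re z" by blast
qed

text \<open>A compact set of positive spectral values has a positive minimum, which serves as
  \<open>e\<close>.\<close>

lemma positive_definite_cone_iff_bounded_below:
  "a \<in> positive_definite_cone \<longleftrightarrow> (\<exists>e>0. a - e *\<^sub>R 1 \<in> positive_cone)"
proof
  assume a: "a \<in> positive_definite_cone"
  then have sa: "star a = a" by (rule positive_definite_cone_selfadjoint)
  have "continuous_on (spectrum a) Re" by (intro continuous_intros)
  then obtain w where w: "w \<in> spectrum a" "\<And>z. z \<in> spectrum a \<Longrightarrow> Re w \<le> Re z"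
    using continuous_attains_inf[OF compact_spectrum spectrum_selfadjoint_nonempty[OF sa]] by blast
  have "a - Re w *\<^sub>R 1 \<in> positive_cone"
    using w(2) sa by (subst positive_cone_iff) (force simp: star_diff star_scaleR spectrum_diff_scalar)+
  moreover have "Re w > 0" using a w(1) positive_definite_cone_iff[OF sa] by blast
  ultimately show "\<exists>e>0. a - e *\<^sub>R 1 \<in> positive_cone" by blast
next
  assume "\<exists>e>0. a - e *\<^sub>R 1 \<in> positive_cone"
  then obtain e where e: "e > 0" "a - e *\<^sub>R 1 \<in> positive_cone" by blast
  have sa: "star a = a"
    using positive_cone_selfadjoint[OF e(2)] by (simp add: star_diff star_scaleR)
  have "0 < Re z" if "z \<in> spectrum a" for z
  proof -
    have "z - of_real e \<in> spectrum (a - e *\<^sub>R 1)" using that by (simp add: spectrum_diff_scalar)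
    then have "0 \<le> Re (z - of_real e)"
      using e(2) positive_cone_iff[OF positive_cone_selfadjoint[OF e(2)]] by blast
    then show ?thesis using e(1) by simp
  qed
  then show "a \<in> positive_definite_cone" by (simp add: positive_definite_cone_iff[OF sa])
qed

lemma positive_definite_cone_add_positive:
  assumes "a \<in> positive_definite_cone" "b \<in> positive_cone"
  shows "a + b \<in> positive_definite_cone"
proof -
  obtain e where "e > 0" "a - e *\<^sub>R 1 \<in> positive_cone"
    using assms(1) positive_definite_cone_iff_bounded_below by blast
  then show ?thesis
    using positive_cone_add[OF _ assms(2)] unfolding positive_definite_cone_iff_bounded_below
    by (force simp: algebra_simps)
qed

lemma positive_definite_cone_add:
  "a \<in> positive_definite_cone \<Longrightarrow> b \<in> positive_definite_cone \<Longrightarrow> a + b \<in> positive_definite_cone"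
  using positive_definite_cone_add_positive positive_definite_cone_subset by blast

lemma positive_definite_cone_scaleR:
  assumes "a \<in> positive_definite_cone" "r > 0"
  shows "r *\<^sub>R a \<in> positive_definite_cone"
proof -
  obtain e where e: "e > 0" "a - e *\<^sub>R 1 \<in> positive_cone"
    using assms(1) positive_definite_cone_iff_bounded_below by blast
  have "r *\<^sub>R a - (r * e) *\<^sub>R 1 \<in> positive_cone"
    using positive_cone_scaleR[OF e(2), of r] assms(2) by (simp add: scaleR_diff_right)
  then show ?thesis
    using e(1) assms(2) unfolding positive_definite_cone_iff_bounded_below
    by (intro exI[of _ "r * e"]) auto
qed

lemma positive_definite_cone_one: "1 \<in> positive_definite_cone"
  by (simp add: positive_definite_cone_def positive_cone_one)

lemma selfadjoint_add_positive_definite: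
  assumes "star x = x"
  shows "x + (norm x + 1) *\<^sub>R 1 \<in> positive_definite_cone"
proof -
  have "x + (norm x + 1) *\<^sub>R 1 - 1 *\<^sub>R 1 = norm x *\<^sub>R 1 - (- x)"
    by (simp add: scaleR_add_left)
  also have "\<dots> \<in> positive_cone"
    using assms by (intro norm_minus_selfadjoint_positive) (simp_all add: star_minus)
  finally show ?thesis
    unfolding positive_definite_cone_iff_bounded_below using zero_less_one by blast
qed

lemma selfadjoint_eq_diff_positive_definite:
  assumes "star x = x"
  shows "\<exists>a\<in>positive_definite_cone. \<exists>b\<in>positive_definite_cone. x = a - b"
proof (intro bexI)
  show "x = (x + (norm x + 1) *\<^sub>R 1) - (norm x + 1) *\<^sub>R 1" by simp
  show "(norm x + 1) *\<^sub>R 1 \<in> positive_definite_cone"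
    by (intro positive_definite_cone_scaleR positive_definite_cone_one) (simp add: add_nonneg_pos)
qed (rule selfadjoint_add_positive_definite[OF assms])

lemma spectrum_mult_commute:
  fixes x y :: "'a::cstar_algebra"
  assumes "z \<in> spectrum (x * y)" "z \<noteq> 0"
  shows "z \<in> spectrum (y * x)"
proof (rule ccontr)
  assume "z \<notin> spectrum (y * x)"
  then obtain c where c: "(y * x - z *\<^sub>C 1) * c = 1" "c * (y * x - z *\<^sub>C 1) = 1"
    unfolding spectrum_def two_sided_unit_def by blast
  have c': "y * x * c = 1 + z *\<^sub>C c" "c * (y * x) = 1 + z *\<^sub>C c"
    using c by (simp_all add: left_diff_distrib right_diff_distrib mult_scaleC_left mult_scaleC_right
        diff_eq_eq mult.assoc)
  \<comment> \<open>Jacobson's formula: an inverse \<open>c\<close> of \<open>y x - z\<close> yields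
    this inverse of \<open>x y - z\<close>.\<close>
  let ?d = "inverse z *\<^sub>C (x * c * y - 1)"
  have "x * y * (x * c * y) = x * (y * x * c) * y" "x * c * y * (x * y) = x * (c * (y * x)) * y"
    by (simp_all only: mult.assoc)
  then have "x * y * (x * c * y) = x * y + z *\<^sub>C (x * c * y)"
    "x * c * y * (x * y) = x * y + z *\<^sub>C (x * c * y)"
    by (simp_all add: c' distrib_left distrib_right mult_scaleC_left mult_scaleC_right)
  then have "(x * y - z *\<^sub>C 1) * (x * c * y - 1) = z *\<^sub>C 1"
    "(x * c * y - 1) * (x * y - z *\<^sub>C 1) = z *\<^sub>C 1"
    by (simp_all add: left_diff_distrib right_diff_distrib mult_scaleC_left mult_scaleC_right scaleC_diff_right)
  then have "two_sided_unit (x * y - z *\<^sub>C 1)"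
    unfolding two_sided_unit_def using assms(2)
    by (intro exI[of _ ?d]) (simp add: mult_scaleC_left mult_scaleC_right scaleC_scaleC)
  then show False using assms(1) by (simp add: spectrum_def)
qed

lemma selfadjoint_square_positive:
  assumes "star h = h"
  shows "h * h \<in> positive_cone"
proof -
  have "cfc (\<lambda>z. z * z) h \<in> positive_cone"
    using spectrum_selfadjoint_real[OF assms]
    by (intro cfc_positive assms continuous_intros) auto
  then show ?thesis by (simp add: cfc_mult[OF assms] cfc_id[OF assms])
qed

section \<open>Real and imaginary parts, and positivity of \<open>star x * x\<close>\<close>

definition re_part :: "'a::cstar_algebra \<Rightarrow> 'a" where
  "re_part x = (1/2) *\<^sub>C (x + star x)"

definition im_part :: "'a::cstar_algebra \<Rightarrow> 'a" where
  "im_part x = (- \<i> / 2) *\<^sub>C (x - star x)"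

lemma star_re_part [simp]: "star (re_part x) = re_part x"
  by (simp add: re_part_def star_scaleC star_add star_star add.commute)

lemma star_im_part [simp]: "star (im_part x) = im_part x"
  by (simp add: im_part_def star_scaleC star_diff star_star scaleC_diff_right scaleC_minus_left)

lemma re_part_add_im_part: "re_part x + \<i> *\<^sub>C im_part x = x"
proof -
  have "\<i> *\<^sub>C im_part x = (1/2) *\<^sub>C (x - star x)" by (simp add: im_part_def scaleC_scaleC)
  then have "re_part x + \<i> *\<^sub>C im_part x = (1/2 + 1/2) *\<^sub>C x"
    unfolding re_part_def scaleC_add_left by (simp add: scaleC_add_right scaleC_diff_right)
  then show ?thesis by simp
qed

lemma re_im_part_unique:
  assumes "star h = h" "star k = k"
  shows "re_part (h + \<i> *\<^sub>C k) = h" "im_part (h + \<i> *\<^sub>C k) = k"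
proof -
  have "re_part (h + \<i> *\<^sub>C k) = (1/2 + 1/2) *\<^sub>C h"
    unfolding re_part_def scaleC_add_left
    by (simp add: assms star_add star_scaleC scaleC_minus_left scaleC_add_right scaleC_diff_right)
  then show "re_part (h + \<i> *\<^sub>C k) = h" by simp
  have "im_part (h + \<i> *\<^sub>C k) = (1/2 + 1/2) *\<^sub>C k"
    unfolding im_part_def scaleC_add_left
    by (simp add: assms star_add star_scaleC scaleC_minus_left scaleC_add_right scaleC_scaleC)
  then show "im_part (h + \<i> *\<^sub>C k) = k" by simp
qed

lemma norm_re_part_le: "norm (re_part x) \<le> norm x"
  using norm_triangle_ineq[of x "star x"] by (simp add: re_part_def norm_scaleC norm_divide)

lemma norm_im_part_le: "norm (im_part x) \<le> norm x"
  using norm_triangle_ineq4[of x "star x"] by (simp add: im_part_def norm_scaleC norm_divide)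

text \<open>For \<open>x = h + i k\<close> with self-adjoint \<open>h\<close> and \<open>k\<close>
  the mixed terms cancel, leaving \<open>2 (h^2 + k^2)\<close>.\<close>

lemma star_mult_self_add_positive: "star x * x + x * star x \<in> positive_cone"
proof -
  obtain h k where hk: "star h = h" "star k = k" "x = h + \<i> *\<^sub>C k"
    using re_part_add_im_part star_re_part star_im_part by metis
  have "star x * x + x * star x = 2 *\<^sub>R (h * h + k * k)"
    using hk by (simp add: star_add star_scaleC algebra_simps mult_scaleC_left mult_scaleC_right
        scaleC_scaleC scaleC_minus_left scaleC_add_right scaleC_diff_right scaleR_2 scaleC_minus_right)
  then show ?thesis
    using hk by (simp add: positive_cone_add positive_cone_scaleR selfadjoint_square_positive)
qed

text \<open>With \<open>n\<close> the negative part of \<open>b = x\<^sup>* x\<close> and \<open>y = x n\<close>, the element \<open>y\<^sup>* y = - n\<^sup>3\<close> is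
  negative; but \<open>y y\<^sup>*\<close> is positive and has the same nonzero spectrum, so \<open>n\<^sup>3 = 0\<close>.\<close>

lemma star_mult_self_positive: "star x * x \<in> positive_cone"
proof -
  define b where "b = star x * x"
  have sa: "star b = b" by (simp add: b_def star_mult star_star)
  define g where "g = (\<lambda>z. complex_of_real (max 0 (- Re z)))"
  have cg: "continuous_on (spectrum b) g" unfolding g_def by (intro continuous_intros)
  have cg3: "continuous_on (spectrum b) (\<lambda>z. g z * g z * g z)" by (intro continuous_intros cg)
  define n where "n = cfc g b"
  have sn: "star n = n" unfolding n_def by (rule cfc_selfadjoint[OF sa cg]) (simp add: g_def)
  have n3: "n * n * n = cfc (\<lambda>z. g z * g z * g z) b"
    unfolding n_def using cg by (simp add: cfc_mult[OF sa] continuous_on_mult)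
  have "n * b * n = cfc (\<lambda>z. g z * z * g z) b"
    unfolding n_def using cg by (simp add: cfc_mult[OF sa] continuous_on_mult cfc_id[OF sa])
  \<comment> \<open>\<open>g\<close> is the negative part on the real line: where it is nonzero,
    \<open>g z = - z\<close>.\<close>
  also have "\<dots> = cfc (\<lambda>z. - (g z * g z * g z)) b"
  proof (rule cfc_cong[OF sa])
    fix z assume "z \<in> spectrum b"
    then have z: "z = of_real (Re z)" by (rule spectrum_selfadjoint_of_real[OF sa])
    show "g z * z * g z = - (g z * g z * g z)"
    proof (cases "Re z \<ge> 0")
      case False
      then have "g z = - z" by (subst (2) z) (simp add: g_def)
      then show ?thesis by simp
    qed (simp add: g_def)
  qed (intro continuous_intros cg)
  also have "\<dots> = - (n * n * n)" by (simp add: cfc_minus[OF sa cg3] n3)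
  finally have nbn: "n * b * n = - (n * n * n)" .
  have n3_pos: "n * n * n \<in> positive_cone"
    unfolding n3 by (intro cfc_positive sa cg3) (simp add: g_def)
  define y where "y = x * n"
  have yy: "star y * y = - (n * n * n)"
    by (simp add: y_def star_mult sn flip: nbn) (simp add: b_def mult.assoc)
  \<comment> \<open>Although \<open>star y * y\<close> is negative, adding it to
    \<open>y * star y\<close> gives a positive element, and \<open>n * n * n\<close> restores what
    was added.\<close>
  have "y * star y = (star y * y + y * star y) + n * n * n" by (simp add: yy)
  then have pos: "y * star y \<in> positive_cone"
    using positive_cone_add[OF star_mult_self_add_positive n3_pos] by metis
  have "star y * y \<in> positive_cone"
  proof (subst positive_cone_iff)
    have "0 \<le> Re z" if "z \<in> spectrum (star y * y)" for z
    proof (cases "z = 0")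
      case False
      then have "z \<in> spectrum (y * star y)" using spectrum_mult_commute that by blast
      then show ?thesis using pos positive_cone_iff[OF positive_cone_selfadjoint[OF pos]] by blast
    qed simp
    then show "\<forall>z\<in>spectrum (star y * y). 0 \<le> Re z" by blast
  qed (simp add: star_mult star_star)
  then have "n * n * n = 0"
    using positive_cone_antisym[OF n3_pos] yy by simp
  then have "g z * g z * g z = 0" if "z \<in> spectrum b" for z
    using norm_cfc_ge[OF sa cg3 that] n3 by simp
  then have "0 \<le> Re z" if "z \<in> spectrum b" for z
    using that by (fastforce simp: g_def max_def split: if_splits)
  then have "b \<in> positive_cone" by (simp add: positive_cone_iff[OF sa])
  then show ?thesis by (simp add: b_def)
qed

lemma positive_sqrt_exists:
  assumes "a \<in> positive_cone"
  shows "\<exists>q. star q = q \<and> q * q = a"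
proof -
  have sa: "star a = a" using assms positive_cone_selfadjoint by blast
  let ?f = "\<lambda>z. complex_of_real (sqrt (Re z))"
  have c: "continuous_on (spectrum a) ?f" by (intro continuous_intros)
  have "cfc ?f a * cfc ?f a = cfc (\<lambda>z. ?f z * ?f z) a" by (rule cfc_mult[OF sa c c, symmetric])
  also have "\<dots> = cfc (\<lambda>z. z) a"
  proof (rule cfc_cong[OF sa])
    fix z assume z: "z \<in> spectrum a"
    then have "0 \<le> Re z" using assms positive_cone_iff[OF sa] by blast
    then have "?f z * ?f z = of_real (Re z)" by (simp flip: of_real_mult)
    then show "?f z * ?f z = z" using spectrum_selfadjoint_of_real[OF sa z] by simp
  qed (intro continuous_intros c)
  finally have "cfc ?f a * cfc ?f a = a" by (simp add: cfc_id[OF sa])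
  moreover have "star (cfc ?f a) = cfc ?f a" by (rule cfc_selfadjoint[OF sa c]) simp
  ultimately show ?thesis by blast
qed

text \<open>With a self-adjoint square root \<open>q\<close> of \<open>a\<close>, the element is
  \<open>star (q * d) * (q * d)\<close>.\<close>

lemma positive_cone_conjugate:
  assumes "a \<in> positive_cone" "star d = d"
  shows "d * a * d \<in> positive_cone"
proof -
  obtain q where q: "star q = q" "q * q = a" using positive_sqrt_exists[OF assms(1)] by blast
  have "star (q * d) * (q * d) = d * a * d" using q(1) assms(2) by (simp add: star_mult mult.assoc flip: q(2))
  then show ?thesis using star_mult_self_positive by metis
qed

lemma positive_definite_cone_conjugate:
  assumes "a \<in> positive_definite_cone" "d \<in> positive_definite_cone"
  shows "d * a * d \<in> positive_definite_cone"
  using assms positive_cone_conjugate[of a d] unfolding positive_definite_cone_def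
  by (auto intro: two_sided_unit_mult positive_cone_selfadjoint)

section \<open>Real powers of positive definite elements\<close>

context
  fixes a :: "'a::cstar_algebra"
  assumes a: "a \<in> positive_definite_cone"
begin

private lemma sa: "star a = a"
  using a by (rule positive_definite_cone_selfadjoint)

private lemma pos: "z \<in> spectrum a \<Longrightarrow> 0 < Re z"
  using a positive_definite_cone_iff[OF sa] by blast

lemma continuous_on_spectrum_powr:
  "continuous_on (spectrum a) (\<lambda>z. complex_of_real (Re z powr p))"
  using pos by (auto intro!: continuous_intros simp: less_le)

lemma real_power_positive_definite: "real_power a p \<in> positive_definite_cone"
proof -
  have "star (real_power a p) = real_power a p"
    unfolding real_power_def by (rule cfc_selfadjoint[OF sa continuous_on_spectrum_powr]) simp
  then show ?thesis
    by (subst positive_definite_cone_iff)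
      (use pos in \<open>fastforce simp: real_power_def spectrum_cfc[OF sa continuous_on_spectrum_powr]\<close>)+
qed

lemma real_power_one: "real_power a 1 = a"
proof -
  have "real_power a 1 = cfc (\<lambda>z. z) a"
    unfolding real_power_def
    using pos spectrum_selfadjoint_of_real[OF sa]
    by (intro cfc_cong[OF sa] continuous_on_spectrum_powr) (simp add: less_imp_le)
  then show ?thesis by (simp add: cfc_id[OF sa])
qed

lemma real_power_zero: "real_power a 0 = 1"
proof -
  have "real_power a 0 = cfc (\<lambda>z. 1) a"
    unfolding real_power_def using pos
    by (intro cfc_cong[OF sa] continuous_on_spectrum_powr) force
  then show ?thesis by (simp add: cfc_const[OF sa])
qed

lemma real_power_add: "real_power a (p + q) = real_power a p * real_power a q"
  unfolding real_power_def
  using cfc_mult[OF sa continuous_on_spectrum_powr[of p] continuous_on_spectrum_powr[of q]]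
  by (simp add: powr_add)

lemma real_power_real_power: "real_power (real_power a p) q = real_power a (p * q)"
proof -
  let ?f = "\<lambda>p z. complex_of_real (Re z powr p)"
  have "continuous_on (?f p ` spectrum a) (?f q)"
    using real_power_positive_definite[of p] positive_definite_cone_iff[of "real_power a p"]
      positive_definite_cone_selfadjoint[of "real_power a p"]
    by (fastforce intro!: continuous_intros simp: real_power_def spectrum_cfc[OF sa continuous_on_spectrum_powr])
  then show ?thesis
    unfolding real_power_def
    by (subst cfc_compose[OF sa continuous_on_spectrum_powr]) (auto simp: powr_powr)
qed

end

lemma real_power_inverse:
  assumes "a \<in> positive_definite_cone" "p \<noteq> 0"
  shows "real_power (real_power a p) (1 / p) = a" "real_power (real_power a (1 / p)) p = a"
  using assms by (simp_all add: real_power_real_power real_power_one)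

lemma mean_positive_definite:
  "a \<in> positive_definite_cone \<Longrightarrow> b \<in> positive_definite_cone \<Longrightarrow> (a + b) /\<^sub>R 2 \<in> positive_definite_cone"
  by (simp add: positive_definite_cone_add positive_definite_cone_scaleR)

section \<open>Jordan *-isomorphisms\<close>

lemma poly_at_commute: "a * poly_at q a = poly_at q a * a"
  using poly_at_mult[of "[:0, 1:]" q a] poly_at_mult[of q "[:0, 1:]" a] by (simp add: mult.commute)

lemma double_cancel: "x + x = y + y \<longleftrightarrow> x = (y::'a::real_vector)"
  by (simp flip: scaleR_2)

lemma jordan_star_isomorphism_inv:
  assumes "jordan_star_isomorphism J"
  shows "jordan_star_isomorphism (inv J)"
proof -
  have bij: "bij J" and hom: "\<And>A B. J (A + B) = J A + J B" "\<And>c A. J (c *\<^sub>C A) = c *\<^sub>C J A"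
    "\<And>A B. J (A * B + B * A) = J A * J B + J B * J A" "\<And>A. J (star A) = star (J A)"
    using assms by (auto simp: jordan_star_isomorphism_def)
  have J_inv: "J (inv J y) = y" for y using bij by (simp add: bij_is_surj surj_f_inv_f)
  have inv_eq: "inv J y = x" if "J x = y" for x y
    using bij that by (metis bij_is_inj inv_f_f)
  have "J (inv J A * inv J B + inv J B * inv J A) = A * B + B * A" for A B
    by (simp only: hom(3) J_inv)
  then show ?thesis
    unfolding jordan_star_isomorphism_def
    using bij_imp_bij_inv[OF bij] by (auto intro!: inv_eq simp: hom J_inv)
qed

context
  fixes J :: "'a::cstar_algebra \<Rightarrow> 'b::cstar_algebra"
  assumes J: "jordan_star_isomorphism J"
begin

private lemma
  bij_J: "bij J" and J_add: "J (x + y) = J x + J y" and J_scaleC: "J (c *\<^sub>C x) = c *\<^sub>C J x" and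
  J_jordan: "J (x * y + y * x) = J x * J y + J y * J x" and J_star: "J (star x) = star (J x)"
  using J by (auto simp: jordan_star_isomorphism_def)

lemma jordan_zero: "J 0 = 0"
  using J_scaleC[of 0 0] by simp

lemma jordan_diff: "J (x - y) = J x - J y"
  using J_add[of x "(-1) *\<^sub>C y"] J_scaleC[of "-1" y] by (simp add: scaleC_minus_left)

lemma jordan_scaleR: "J (r *\<^sub>R x) = r *\<^sub>R J x"
  by (simp add: scaleR_scaleC J_scaleC)

text \<open>The Jordan identity is applied to 1 and a preimage \<open>e\<close> of 1.\<close>

lemma jordan_one: "J 1 = 1"
proof -
  obtain e where e: "J e = 1" using bij_J by (metis bij_is_surj surjD)
  have "J (e * 1 + 1 * e) = 1 * J 1 + J 1 * 1"
    using J_jordan[of e 1] e by simp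
  then have "1 + 1 = J 1 + J 1" by (simp only: J_add e mult_1_left mult_1_right)
  then show ?thesis by (simp only: double_cancel)
qed

lemma jordan_mult_commuting:
  assumes "x * y = y * x" "J x * J y = J y * J x"
  shows "J (x * y) = J x * J y"
  using J_jordan[of x y] assms by (simp add: J_add double_cancel)

lemma jordan_triple: "J (x * y * x) = J x * J y * J x"
proof -
  \<comment> \<open>Twice the triple product is expressed by Jordan products and squares, all of
    which \<open>J\<close> preserves.\<close>
  have id: "u * v * u + u * v * u = (u * (u * v + v * u) + (u * v + v * u) * u) - ((u * u) * v + v * (u * u))"
    for u v :: "'c::ring" by (simp add: algebra_simps)
  have sq: "J (x * x) = J x * J x" by (rule jordan_mult_commuting) simp_all
  have "J (x * y * x) + J (x * y * x) = J (x * y * x + x * y * x)" by (simp add: J_add)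
  also have "\<dots> = J x * J y * J x + J x * J y * J x"
    unfolding id by (simp add: jordan_diff J_jordan sq)
  finally show ?thesis by (simp add: double_cancel)
qed

text \<open>If \<open>y\<close> inverts \<open>x\<close>, then \<open>x * y^2 * x = 1\<close>, and
  the triple product rule gives \<open>J x * J (y^2) * J x = 1\<close>; bracketing it in both ways
  exhibits a right and a left inverse.\<close>

lemma jordan_two_sided_unit:
  assumes "two_sided_unit x"
  shows "two_sided_unit (J x)"
proof -
  obtain y where y: "x * y = 1" "y * x = 1" using assms unfolding two_sided_unit_def by blast
  have "x * (y * y) * x = (x * y) * (y * x)" by (simp only: mult.assoc)
  then have "J x * J (y * y) * J x = 1"
    using jordan_triple[of x "y * y"] y jordan_one by simp
  then have "J x * (J (y * y) * J x) = 1" "(J x * J (y * y)) * J x = 1"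
    by (simp_all add: mult.assoc)
  then show ?thesis by (rule two_sided_unitI[rotated])
qed

text \<open>\<open>J\<close> is multiplicative on pairs that commute both before and after applying
  it; the induction hypothesis supplies the commutation of the images.\<close>

lemma jordan_poly_at: "J (poly_at q x) = poly_at q (J x)"
proof (induction q)
  case (pCons c q)
  have "J (x * poly_at q x) = J x * J (poly_at q x)"
    by (rule jordan_mult_commuting) (simp_all add: poly_at_commute pCons.IH)
  then show ?case by (simp add: J_add J_scaleC jordan_one pCons.IH)
qed (simp add: jordan_zero)

end

section \<open>Jordan isomorphisms, spectra and functional calculus\<close>

context
  fixes J :: "'a::cstar_algebra \<Rightarrow> 'b::cstar_algebra"
  assumes J: "jordan_star_isomorphism J"
begin

lemma jordan_spectrum: "spectrum (J x) = spectrum x"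
proof -
  have bij: "bij J" and scale: "\<And>c A. J (c *\<^sub>C A) = c *\<^sub>C J A"
    using J by (auto simp: jordan_star_isomorphism_def)
  have "two_sided_unit (J y) \<longleftrightarrow> two_sided_unit y" for y
    using jordan_two_sided_unit[OF J, of y] jordan_two_sided_unit[OF jordan_star_isomorphism_inv[OF J], of "J y"]
    by (auto simp: bij bij_is_inj)
  moreover have "J (x - z *\<^sub>C 1) = J x - z *\<^sub>C 1" for z
    by (simp add: jordan_diff[OF J] scale jordan_one[OF J])
  ultimately show ?thesis by (simp add: spectrum_def) metis
qed

lemma jordan_selfadjoint: "star x = x \<Longrightarrow> star (J x) = J x"
  using J by (metis jordan_star_isomorphism_def)

lemma jordan_norm_selfadjoint:
  assumes "star x = x"
  shows "norm (J x) = norm x"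
  using spectrum_attains_norm[OF assms] spectrum_attains_norm[OF jordan_selfadjoint[OF assms]]
    spectrum_norm_le[of _ x] spectrum_norm_le[of _ "J x"]
  by (metis antisym jordan_spectrum)

text \<open>\<open>J\<close> is isometric on self-adjoint elements because it preserves spectra; the
  factor 2 comes from adding real and imaginary parts. Continuity is what \<open>jordan_cfc\<close>
  takes from it.\<close>

lemma jordan_norm_le: "norm (J x) \<le> 2 * norm x"
proof -
  have "J x = J (re_part x + \<i> *\<^sub>C im_part x)" by (simp add: re_part_add_im_part)
  also have "\<dots> = J (re_part x) + \<i> *\<^sub>C J (im_part x)"
    using J by (simp add: jordan_star_isomorphism_def)
  also have "norm \<dots> \<le> norm (re_part x) + norm (im_part x)"
    by (rule norm_triangle_le) (simp add: norm_scaleC jordan_norm_selfadjoint)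
  finally show ?thesis using norm_re_part_le[of x] norm_im_part_le[of x] by simp
qed

lemma jordan_bounded_linear: "bounded_linear J"
  using jordan_norm_le J
  by (intro bounded_linear_intro[of _ 2]) (auto simp: jordan_scaleR[OF J] jordan_star_isomorphism_def mult.commute)

lemma jordan_cfc:
  assumes "star x = x" "continuous_on (spectrum x) f"
  shows "J (cfc f x) = cfc f (J x)"
proof -
  obtain q where q: "uniform_limit (spectrum x) (\<lambda>n. poly (q n)) f sequentially"
      "(\<lambda>n. poly_at (q n) x) \<longlonglongrightarrow> cfc f x"
    using poly_limit_cfc[OF assms] unfolding poly_limit_def by blast
  have "(\<lambda>n. poly_at (q n) (J x)) \<longlonglongrightarrow> J (cfc f x)"
    using bounded_linear.tendsto[OF jordan_bounded_linear q(2)] by (simp add: jordan_poly_at[OF J])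
  then have "poly_limit (J x) f (J (cfc f x))"
    using q(1) unfolding poly_limit_def by (intro exI[of _ q]) (simp add: jordan_spectrum)
  then show ?thesis using cfc_eqI[OF jordan_selfadjoint[OF assms(1)]] by simp
qed

lemma jordan_positive_definite:
  assumes "x \<in> positive_definite_cone"
  shows "J x \<in> positive_definite_cone"
proof -
  have "star x = x" using assms by (rule positive_definite_cone_selfadjoint)
  then show ?thesis
    using assms positive_definite_cone_iff[of x] positive_definite_cone_iff[of "J x"]
    by (simp add: jordan_selfadjoint jordan_spectrum)
qed

lemma jordan_real_power:
  assumes "x \<in> positive_definite_cone"
  shows "J (real_power x p) = real_power (J x) p"
  unfolding real_power_def
  using positive_definite_cone_selfadjoint[OF assms] continuous_on_spectrum_powr[OF assms]
  by (rule jordan_cfc)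

text \<open>On \<open>p\<close>-th powers \<open>\<phi>\<close> acts as the linear map sending
  \<open>X\<close> to \<open>D * J X * D\<close>, and the power mean becomes the arithmetic
  mean.\<close>

lemma jordan_conjugate_preserves_power_mean:
  assumes p: "p \<noteq> 0" and D: "D \<in> positive_definite_cone"
    and \<phi>: "\<And>A. A \<in> positive_definite_cone \<Longrightarrow> \<phi> A = real_power (D * real_power (J A) p * D) (1 / p)"
    and A: "A \<in> positive_definite_cone" and B: "B \<in> positive_definite_cone"
  shows "\<phi> (power_mean p A B) = power_mean p (\<phi> A) (\<phi> B)"
proof -
  note [simp] = real_power_positive_definite jordan_positive_definite
  let ?M = "(real_power A p + real_power B p) /\<^sub>R 2"
  have M: "?M \<in> positive_definite_cone" using A B by (intro mean_positive_definite) simp_all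
  have \<phi>_power: "real_power (\<phi> X) p = D * real_power (J X) p * D" if "X \<in> positive_definite_cone" for X
    using that D p by (simp add: \<phi> real_power_inverse positive_definite_cone_conjugate)
  have "real_power (J (real_power ?M (1 / p))) p = J ?M"
    using M p by (simp add: jordan_real_power real_power_inverse)
  also have "\<dots> = (real_power (J A) p + real_power (J B) p) /\<^sub>R 2"
    using J A B by (simp only: jordan_scaleR[OF J] jordan_real_power[symmetric] jordan_star_isomorphism_def)
  finally have "\<phi> (power_mean p A B) =
      real_power (D * ((real_power (J A) p + real_power (J B) p) /\<^sub>R 2) * D) (1 / p)"
    unfolding power_mean_def using M by (simp add: \<phi>)
  also have "D * ((real_power (J A) p + real_power (J B) p) /\<^sub>R 2) * D =
      (real_power (\<phi> A) p + real_power (\<phi> B) p) /\<^sub>R 2"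
    by (simp add: \<phi>_power A B distrib_left distrib_right)
  finally show ?thesis by (simp add: power_mean_def)
qed

end

section \<open>Kadison's inequality and unital order isomorphisms\<close>

text \<open>HOL functions are total, so \<open>T\<close> is constrained only on self-adjoint
  elements; its values elsewhere are arbitrary.\<close>

definition positive_linear_on_selfadjoint :: "('a::cstar_algebra \<Rightarrow> 'b::cstar_algebra) \<Rightarrow> bool" where
  "positive_linear_on_selfadjoint T \<longleftrightarrow>
     (\<forall>x y. star x = x \<longrightarrow> star y = y \<longrightarrow> T (x + y) = T x + T y) \<and>
     (\<forall>r x. star x = x \<longrightarrow> T (r *\<^sub>R x) = r *\<^sub>R T x) \<and>
     (\<forall>x\<in>positive_cone. T x \<in> positive_cone)"

context
  fixes T :: "'a::cstar_algebra \<Rightarrow> 'b::cstar_algebra"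
  assumes T: "positive_linear_on_selfadjoint T"
begin

lemma positive_linear_add: "star x = x \<Longrightarrow> star y = y \<Longrightarrow> T (x + y) = T x + T y"
  and positive_linear_scaleR: "star x = x \<Longrightarrow> T (r *\<^sub>R x) = r *\<^sub>R T x"
  and positive_linear_positive: "x \<in> positive_cone \<Longrightarrow> T x \<in> positive_cone"
  using T by (auto simp: positive_linear_on_selfadjoint_def)

lemma positive_linear_zero: "T 0 = 0"
  using positive_linear_scaleR[of 0 0] by simp

lemma positive_linear_diff: "star x = x \<Longrightarrow> star y = y \<Longrightarrow> T (x - y) = T x - T y"
  using positive_linear_add[of x "(-1) *\<^sub>R y"] positive_linear_scaleR[of y "-1"]
  by (simp add: star_minus)

lemma positive_linear_sum:
  "(\<And>i. i \<in> I \<Longrightarrow> star (f i) = f i) \<Longrightarrow> T (sum f I) = (\<Sum>i\<in>I. T (f i))"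
proof (induction I rule: infinite_finite_induct)
  case (insert i I)
  have "T (f i + sum f I) = T (f i) + T (sum f I)"
    using insert.prems by (intro positive_linear_add) (simp_all add: star_sum)
  then show ?case using insert by simp
qed (simp_all add: positive_linear_zero)

lemma positive_linear_selfadjoint:
  assumes "star x = x"
  shows "star (T x) = T x"
proof -
  obtain a b where ab: "a \<in> positive_cone" "b \<in> positive_cone" "x = a - b"
    using selfadjoint_eq_diff_positive_definite[OF assms] positive_definite_cone_subset by blast
  then have "T x = T a - T b"
    by (simp add: positive_linear_diff positive_cone_selfadjoint)
  then show ?thesis
    using ab by (simp add: star_diff positive_cone_selfadjoint positive_linear_positive)
qed

text \<open>With \<open>X = T a\<close> and the positive elements \<open>P\<^sub>k\<close> that \<open>T\<close> assigns to the Bernstein partition of unity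
  at \<open>a\<close>, the sum of \<open>(\<lambda>\<^sub>k - X) P\<^sub>k (\<lambda>\<^sub>k - X)\<close> is positive and differs from \<open>T (a\<^sup>2) - X\<^sup>2\<close> only by the
  Bernstein approximation error for the square function, which is of order \<open>1 / n\<close>.\<close>

lemma kadison_inequality:
  assumes one: "T 1 = 1" and sa: "star a = a"
  shows "T (a * a) - T a * T a \<in> positive_cone"
proof -
  \<comment> \<open>The interval from \<open>- t\<close> to \<open>t\<close> contains the spectrum,
    and the summand 1 keeps \<open>t\<close> positive for the division in \<open>u\<close>.\<close>
  define t where "t = norm a + 1"
  have t: "t > 0" "norm a \<le> t" by (simp_all add: t_def add_nonneg_pos)
  have approx: "T (a * a) + (1 / real (Suc m)) *\<^sub>R T (t\<^sup>2 *\<^sub>R 1 - a * a) - T a * T a \<in> positive_cone" for m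
  proof -
    define n where "n = Suc m"
    have n: "real n > 0" by (simp add: n_def)
    \<comment> \<open>The nodes \<open>k / n\<close> moved to the interval from \<open>- t\<close>
      to \<open>t\<close>; \<open>u\<close> is the change of variable back to the unit
      interval.\<close>
    define l where "l k = 2 * t * (real k / real n) - t" for k
    define u where "u x = (x + t) / (2 * t)" for x
    define f where "f k z = complex_of_real (Bernstein n k (u (Re z)))" for k z
    define B where "B k = cfc (f k) a" for k
    have cf: "continuous_on (spectrum a) (f k)" for k
      unfolding f_def Bernstein_def u_def using t by (intro continuous_intros) auto
    have u01: "0 \<le> u (Re z) \<and> u (Re z) \<le> 1" if "z \<in> spectrum a" for z
      using spectrum_norm_le[OF that] abs_Re_le_cmod[of z] t by (auto simp: u_def field_simps)
    have B: "B k \<in> positive_cone" for k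
      unfolding B_def by (intro cfc_positive sa cf) (simp add: f_def Bernstein_nonneg u01)
    then have sB: "star (B k) = B k" for k by (rule positive_cone_selfadjoint)
    have sumB: "(\<Sum>k\<le>n. c k *\<^sub>R B k) = cfc (\<lambda>z. of_real (\<Sum>k\<le>n. c k * Bernstein n k (u (Re z)))) a" for c
      unfolding B_def of_real_sum of_real_mult f_def[symmetric]
      by (subst cfc_sum[OF sa]) (simp_all add: cf cfc_scale[OF sa] scaleR_scaleC continuous_on_mult)
    have s1: "(\<Sum>k\<le>n. real k * Bernstein n k x) = real n * x"
      and s2: "(\<Sum>k\<le>n. (real k)\<^sup>2 * Bernstein n k x) = real n * (real n - 1) * x\<^sup>2 + real n * x" for x
    proof -
      show "(\<Sum>k\<le>n. real k * Bernstein n k x) = real n * x" by simp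
      have "(\<Sum>k\<le>n. (real k)\<^sup>2 * Bernstein n k x) =
          (\<Sum>k\<le>n. real k * (real k - 1) * Bernstein n k x + real k * Bernstein n k x)"
        by (intro sum.cong) (simp_all add: power2_eq_square algebra_simps)
      then show "(\<Sum>k\<le>n. (real k)\<^sup>2 * Bernstein n k x) = real n * (real n - 1) * x\<^sup>2 + real n * x"
        by (simp only: sum.distrib sum_kk_Bernstein sum_k_Bernstein)
    qed
    have B0: "(\<Sum>k\<le>n. B k) = 1"
      using sumB[of "\<lambda>_. 1"] by (simp add: cfc_const[OF sa])
    have lin: "(\<Sum>k\<le>n. l k * Bernstein n k (u x)) = x" for x
    proof -
      have "(\<Sum>k\<le>n. l k * Bernstein n k (u x)) =
          (2 * t / real n) * (\<Sum>k\<le>n. real k * Bernstein n k (u x)) - t * (\<Sum>k\<le>n. Bernstein n k (u x))"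
        by (simp only: sum_distrib_left flip: sum_subtractf) (simp add: l_def algebra_simps)
      also have "\<dots> = x" using n t by (simp only: s1 sum_Bernstein) (simp add: u_def field_simps)
      finally show ?thesis .
    qed
    have "(\<Sum>k\<le>n. l k *\<^sub>R B k) = cfc (\<lambda>z. complex_of_real (Re z)) a" by (simp only: sumB lin)
    also have "\<dots> = cfc (\<lambda>z. z) a"
      by (intro cfc_cong[OF sa] continuous_intros) (simp add: spectrum_selfadjoint_of_real[OF sa, symmetric])
    finally have B1: "(\<Sum>k\<le>n. l k *\<^sub>R B k) = a" by (simp add: cfc_id[OF sa])
    \<comment> \<open>Binomial second moment: mean \<open>x\<close>, variance
      \<open>4 t^2 u(x) (1 - u(x)) / n = (t^2 - x^2) / n\<close>.\<close>
    have quad: "(\<Sum>k\<le>n. (l k)\<^sup>2 * Bernstein n k (u x)) = x * x + (1 / real n) * (t\<^sup>2 - x * x)" for x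
    proof -
      have "(\<Sum>k\<le>n. (l k)\<^sup>2 * Bernstein n k (u x)) =
          (2 * t / real n)\<^sup>2 * (\<Sum>k\<le>n. (real k)\<^sup>2 * Bernstein n k (u x))
          - (4 * t\<^sup>2 / real n) * (\<Sum>k\<le>n. real k * Bernstein n k (u x)) + t\<^sup>2 * (\<Sum>k\<le>n. Bernstein n k (u x))"
        by (simp only: sum_distrib_left flip: sum_subtractf sum.distrib)
          (simp add: l_def algebra_simps power2_eq_square)
      also have "\<dots> = x * x + (1 / real n) * (t\<^sup>2 - x * x)"
        using n t by (simp only: s1 s2 sum_Bernstein) (simp add: u_def field_simps power2_eq_square)
      finally show ?thesis .
    qed
    have aa: "cfc (\<lambda>z. z * z) a = a * a"
      by (simp add: cfc_mult[OF sa] cfc_id[OF sa])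
    have "(\<Sum>k\<le>n. (l k)\<^sup>2 *\<^sub>R B k) =
        cfc (\<lambda>z. complex_of_real (Re z * Re z + (1 / real n) * (t\<^sup>2 - Re z * Re z))) a"
      by (simp only: sumB quad)
    also have "\<dots> = cfc (\<lambda>z. z * z + of_real (1 / real n) * (of_real (t\<^sup>2) - z * z)) a"
    proof (intro cfc_cong[OF sa] continuous_intros)
      fix z assume "z \<in> spectrum a"
      then have "z = of_real (Re z)" by (rule spectrum_selfadjoint_of_real[OF sa])
      then show "complex_of_real (Re z * Re z + (1 / real n) * (t\<^sup>2 - Re z * Re z)) =
          z * z + of_real (1 / real n) * (of_real (t\<^sup>2) - z * z)"
        by (metis of_real_add of_real_diff of_real_mult)
    qed
    also have "\<dots> = a * a + (1 / real n) *\<^sub>R (t\<^sup>2 *\<^sub>R 1 - a * a)"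
      by (subst cfc_add[OF sa] cfc_scale[OF sa] cfc_diff[OF sa], (intro continuous_intros)+)+
        (simp only: aa cfc_const[OF sa] scaleR_scaleC)
    finally have B2: "(\<Sum>k\<le>n. (l k)\<^sup>2 *\<^sub>R B k) = a * a + (1 / real n) *\<^sub>R (t\<^sup>2 *\<^sub>R 1 - a * a)" .
    define X where "X = T a"
    define P where "P k = T (B k)" for k
    have saa: "star (a * a) = a * a" "star (t\<^sup>2 *\<^sub>R 1 - a * a) = t\<^sup>2 *\<^sub>R 1 - a * a"
      using sa by (simp_all add: star_mult star_diff star_scaleR)
    have sumT: "(\<Sum>k\<le>n. c k *\<^sub>R P k) = T (\<Sum>k\<le>n. c k *\<^sub>R B k)" for c
      unfolding P_def by (subst positive_linear_sum) (simp_all add: star_scaleR sB positive_linear_scaleR)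
    have P0: "(\<Sum>k\<le>n. P k) = 1" using sumT[of "\<lambda>_. 1"] by (simp add: B0 one)
    have P1: "(\<Sum>k\<le>n. l k *\<^sub>R P k) = X" by (simp add: sumT B1 X_def)
    have P2: "(\<Sum>k\<le>n. (l k)\<^sup>2 *\<^sub>R P k) = T (a * a) + (1 / real n) *\<^sub>R T (t\<^sup>2 *\<^sub>R 1 - a * a)"
      unfolding sumT B2 using saa
      by (subst positive_linear_add) (simp_all only: star_scaleR positive_linear_scaleR)
    have "star X = X" unfolding X_def using sa by (rule positive_linear_selfadjoint)
    then have "(\<Sum>k\<le>n. (l k *\<^sub>R 1 - X) * P k * (l k *\<^sub>R 1 - X)) \<in> positive_cone"
      unfolding P_def by (intro positive_cone_sum positive_cone_conjugate positive_linear_positive B)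
        (simp add: star_diff star_scaleR)
    also have "(\<Sum>k\<le>n. (l k *\<^sub>R 1 - X) * P k * (l k *\<^sub>R 1 - X)) =
        (\<Sum>k\<le>n. (l k)\<^sup>2 *\<^sub>R P k - X * (l k *\<^sub>R P k) - (l k *\<^sub>R P k) * X + X * P k * X)"
      by (intro sum.cong refl) (simp add: algebra_simps power2_eq_square)
    also have "\<dots> = (\<Sum>k\<le>n. (l k)\<^sup>2 *\<^sub>R P k) - X * (\<Sum>k\<le>n. l k *\<^sub>R P k)
        - (\<Sum>k\<le>n. l k *\<^sub>R P k) * X + X * (\<Sum>k\<le>n. P k) * X"
      by (simp only: sum_subtractf sum.distrib sum_distrib_left sum_distrib_right)
    \<comment> \<open>The two cross terms contribute \<open>- X * X\<close> each and the last term
      \<open>X * X\<close>.\<close>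
    also have "\<dots> = T (a * a) + (1 / real n) *\<^sub>R T (t\<^sup>2 *\<^sub>R 1 - a * a) - X * X"
      by (simp only: P0 P1 P2) simp
    finally show ?thesis by (simp add: n_def X_def)
  qed
  have lim: "(\<lambda>m. T (a * a) + (1 / real (Suc m)) *\<^sub>R T (t\<^sup>2 *\<^sub>R 1 - a * a) - T a * T a)
      \<longlonglongrightarrow> T (a * a) + 0 *\<^sub>R T (t\<^sup>2 *\<^sub>R 1 - a * a) - T a * T a"
    by (intro tendsto_intros LIMSEQ_Suc[OF lim_const_over_n])
  show ?thesis using positive_cone_closed[OF approx lim] by simp
qed

end

text \<open>Kadison for \<open>S\<close> gives one inequality; Kadison for \<open>S'\<close> at
  \<open>S a\<close>, pushed forward by the order-preserving \<open>S\<close>, gives the reverse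
  one.\<close>

lemma unital_order_isomorphism_square:
  assumes S: "positive_linear_on_selfadjoint S" "S 1 = 1"
    and S': "positive_linear_on_selfadjoint S'" "S' 1 = 1"
    and inv: "\<And>x. star x = x \<Longrightarrow> S' (S x) = x" "\<And>y. star y = y \<Longrightarrow> S (S' y) = y"
    and a: "star a = a"
  shows "S (a * a) = S a * S a"
proof -
  have sS: "star (S a) = S a" using positive_linear_selfadjoint[OF S(1) a] .
  have saa: "star (a * a) = a * a" "star (S a * S a) = S a * S a" using a sS by (simp_all add: star_mult)
  have ge: "S (a * a) - S a * S a \<in> positive_cone" using kadison_inequality[OF S a] .
  have "S' (S a * S a) - a * a \<in> positive_cone"
    using kadison_inequality[OF S' sS] inv(1)[OF a] by simp
  then have "S (S' (S a * S a) - a * a) \<in> positive_cone"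
    by (rule positive_linear_positive[OF S(1)])
  then have "- (S (a * a) - S a * S a) \<in> positive_cone"
    using saa by (simp add: positive_linear_diff[OF S(1)] positive_linear_selfadjoint[OF S'(1)] inv(2))
  then show ?thesis using positive_cone_antisym[OF ge] by simp
qed

text \<open>Preservation of squares polarizes to preservation of \<open>h * k + k * h\<close>; the
  rest is complex-linear extension over real and imaginary parts, with the extension of
  \<open>S'\<close> as inverse.\<close>

lemma unital_order_isomorphism_extends_to_jordan:
  assumes S: "positive_linear_on_selfadjoint S" "S 1 = 1"
    and S': "positive_linear_on_selfadjoint S'" "S' 1 = 1"
    and inv: "\<And>x. star x = x \<Longrightarrow> S' (S x) = x" "\<And>y. star y = y \<Longrightarrow> S (S' y) = y"
  shows "\<exists>J. jordan_star_isomorphism J \<and> (\<forall>x. star x = x \<longrightarrow> J x = S x)"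
proof -
  define J where "J x = S (re_part x) + \<i> *\<^sub>C S (im_part x)" for x
  define J' where "J' y = S' (re_part y) + \<i> *\<^sub>C S' (im_part y)" for y
  note sS [simp] = positive_linear_selfadjoint[OF S(1)] positive_linear_selfadjoint[OF S'(1)]
  note lin = positive_linear_add[OF S(1)] positive_linear_diff[OF S(1)] positive_linear_scaleR[OF S(1)]
  have J: "J (h + \<i> *\<^sub>C k) = S h + \<i> *\<^sub>C S k" if "star h = h" "star k = k" for h k
    using that by (simp add: J_def re_im_part_unique)
  have J': "J' (h + \<i> *\<^sub>C k) = S' h + \<i> *\<^sub>C S' k" if "star h = h" "star k = k" for h k
    using that by (simp add: J'_def re_im_part_unique)
  have "J' (J x) = x" for x
    by (subst J_def, subst J') (simp_all add: inv re_part_add_im_part)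
  moreover have "J (J' y) = y" for y
    by (subst J'_def, subst J) (simp_all add: inv re_part_add_im_part)
  ultimately have bij: "bij J" by (intro o_bij[of J']) (simp_all add: fun_eq_iff)
  have jordan: "S (h * k + k * h) = S h * S k + S k * S h" if hk: "star h = h" "star k = k" for h k
  proof -
    note sq = unital_order_isomorphism_square[OF S S' inv]
    have "h * k + k * h = (h + k) * (h + k) - h * h - k * k" by (simp add: algebra_simps)
    also have "S \<dots> = S (h + k) * S (h + k) - S h * S h - S k * S k"
      using hk by (simp add: lin sq star_add star_mult star_diff)
    also have "\<dots> = S h * S k + S k * S h"
      using hk by (simp add: lin algebra_simps)
    finally show ?thesis .
  qed
  have J_add: "J (x + y) = J x + J y" for x y
  proof -
    have "x + y = (re_part x + re_part y) + \<i> *\<^sub>C (im_part x + im_part y)"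
      using re_part_add_im_part[of x] re_part_add_im_part[of y]
      by (simp add: scaleC_add_right algebra_simps)
    then have "J (x + y) = S (re_part x + re_part y) + \<i> *\<^sub>C S (im_part x + im_part y)"
      using J by (simp add: star_add)
    then show ?thesis by (simp add: J_def lin scaleC_add_right)
  qed
  have J_scaleC: "J (c *\<^sub>C x) = c *\<^sub>C J x" for c x
  proof -
    let ?h = "re_part x" and ?k = "im_part x"
    have c: "c = of_real (Re c) + \<i> * of_real (Im c)" by (rule complex_eq)
    have c_i: "(of_real (Re c) + \<i> * of_real (Im c)) * \<i> = \<i> * of_real (Re c) - of_real (Im c)"
      by (simp add: complex_eq_iff)
    have expand: "c *\<^sub>C (h + \<i> *\<^sub>C k) = (Re c *\<^sub>R h - Im c *\<^sub>R k) + \<i> *\<^sub>C (Im c *\<^sub>R h + Re c *\<^sub>R k)"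
      for h k :: "'d::cstar_algebra"
      by (subst c) (simp add: scaleR_scaleC scaleC_add_left scaleC_add_right scaleC_scaleC
          scaleC_diff_left c_i)
    have "J (c *\<^sub>C x) = J (c *\<^sub>C (?h + \<i> *\<^sub>C ?k))" by (simp add: re_part_add_im_part)
    also have "\<dots> = S (Re c *\<^sub>R ?h - Im c *\<^sub>R ?k) + \<i> *\<^sub>C S (Im c *\<^sub>R ?h + Re c *\<^sub>R ?k)"
      unfolding expand by (rule J) (simp_all add: star_add star_diff star_scaleR)
    also have "\<dots> = c *\<^sub>C J x"
      unfolding J_def expand by (simp add: lin star_scaleR)
    finally show ?thesis .
  qed
  have J_star: "J (star x) = star (J x)" for x
  proof -
    have "star x = star (re_part x + \<i> *\<^sub>C im_part x)" by (simp add: re_part_add_im_part)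
    also have "\<dots> = re_part x + \<i> *\<^sub>C ((-1) *\<^sub>R im_part x)"
      by (simp add: star_add star_scaleC scaleC_minus_left scaleC_minus_right)
    also have "J \<dots> = S (re_part x) + \<i> *\<^sub>C S ((-1) *\<^sub>R im_part x)"
      by (rule J) (simp_all add: star_minus)
    also have "\<dots> = star (J x)"
      unfolding positive_linear_scaleR[OF S(1) star_im_part]
      by (simp add: J_def star_add star_scaleC scaleC_minus_left scaleC_minus_right)
    finally show ?thesis .
  qed
  have J_jordan: "J (x * y + y * x) = J x * J y + J y * J x" for x y
  proof -
    have expand: "(h + \<i> *\<^sub>C k) * (h' + \<i> *\<^sub>C k') + (h' + \<i> *\<^sub>C k') * (h + \<i> *\<^sub>C k) =
        ((h * h' + h' * h) - (k * k' + k' * k)) + \<i> *\<^sub>C ((h * k' + k' * h) + (k * h' + h' * k))"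
      for h k h' k' :: "'d::cstar_algebra"
      by (simp add: algebra_simps mult_scaleC_left mult_scaleC_right scaleC_scaleC scaleC_add_right
          scaleC_minus_left)
    let ?h = "re_part x" and ?k = "im_part x" and ?h' = "re_part y" and ?k' = "im_part y"
    have sa: "star (?h * ?h' + ?h' * ?h) = ?h * ?h' + ?h' * ?h" "star (?k * ?k' + ?k' * ?k) = ?k * ?k' + ?k' * ?k"
      "star (?h * ?k' + ?k' * ?h) = ?h * ?k' + ?k' * ?h" "star (?k * ?h' + ?h' * ?k) = ?k * ?h' + ?h' * ?k"
      by (simp_all add: star_add star_mult add.commute)
    have "x * y + y * x = (?h + \<i> *\<^sub>C ?k) * (?h' + \<i> *\<^sub>C ?k') + (?h' + \<i> *\<^sub>C ?k') * (?h + \<i> *\<^sub>C ?k)"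
      by (simp only: re_part_add_im_part)
    also have "J \<dots> = S ((?h * ?h' + ?h' * ?h) - (?k * ?k' + ?k' * ?k)) +
        \<i> *\<^sub>C S ((?h * ?k' + ?k' * ?h) + (?k * ?h' + ?h' * ?k))"
      unfolding expand by (rule J) (simp_all only: star_add[of "_ + _" "_ + _"] star_diff sa)
    also have "\<dots> = J x * J y + J y * J x"
      unfolding J_def expand using sa by (simp only: lin jordan star_re_part star_im_part)
    finally show ?thesis .
  qed
  have "J x = S x" if "star x = x" for x
    using J[OF that star_zero] by (simp add: positive_linear_zero[OF S(1)])
  then show ?thesis
    using bij J_add J_scaleC J_jordan J_star
    by (intro exI[of _ J]) (simp add: jordan_star_isomorphism_def)
qed

section \<open>Midpoint-affine bijections of positive definite cones\<close>

text \<open>Adding \<open>norm y - y\<close> and \<open>y - x\<close> shows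
  \<open>norm y - x\<close> to be positive, so the spectrum of \<open>x\<close> lies between 0 and
  \<open>norm y\<close>.\<close>

lemma norm_mono_positive:
  assumes "x \<in> positive_cone" "y - x \<in> positive_cone"
  shows "norm x \<le> norm y"
proof -
  have sx: "star x = x" using assms(1) by (rule positive_cone_selfadjoint)
  have "star y = star (y - x) + star x" by (simp add: star_diff)
  then have sy: "star y = y" using positive_cone_selfadjoint[OF assms(2)] sx by simp
  have "(norm y *\<^sub>R 1 - y) + (y - x) \<in> positive_cone"
    using assms(2) norm_minus_selfadjoint_positive[OF sy] by (intro positive_cone_add) auto
  then have pos: "norm y *\<^sub>R 1 - x \<in> positive_cone" by simp
  obtain z where z: "z \<in> spectrum x" "cmod z = norm x" using spectrum_attains_norm[OF sx] by blast
  have "- (z - of_real (norm y)) \<in> spectrum (- (x - norm y *\<^sub>R 1))"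
    using z(1) by (simp only: spectrum_minus minus_minus spectrum_diff_scalar diff_add_cancel)
  then have "0 \<le> Re (- (z - of_real (norm y)))"
    using pos positive_cone_iff[OF positive_cone_selfadjoint[OF pos]] by fastforce
  moreover have "0 \<le> Re z" using z(1) assms(1) positive_cone_iff[OF sx] by blast
  moreover have "cmod z = \<bar>Re z\<bar>"
    by (subst spectrum_selfadjoint_of_real[OF sx z(1)]) (rule norm_of_real)
  ultimately show ?thesis using z(2) by simp
qed

lemma positive_cone_tendsto_shift:
  fixes a b :: "'a::cstar_algebra"
  assumes "\<And>n. a + (1 / real (Suc n)) *\<^sub>R b \<in> positive_cone"
  shows "a \<in> positive_cone"
proof -
  have "(\<lambda>n. a + (1 / real (Suc n)) *\<^sub>R b) \<longlonglongrightarrow> a + 0 *\<^sub>R b"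
    by (intro tendsto_intros LIMSEQ_Suc[OF lim_const_over_n])
  then show ?thesis using positive_cone_closed[OF assms] by simp
qed

text \<open>An additive map which is bounded on \<open>[0, 1]\<close> and vanishes at \<open>1\<close> vanishes on the positive reals,
  since \<open>n g(t) = g(n t)\<close> equals the value of \<open>g\<close> at the fractional part of \<open>n t\<close>.\<close>

lemma additive_bounded_zero:
  fixes g :: "real \<Rightarrow> 'b::real_normed_vector"
  assumes add: "\<And>s t. g (s + t) = g s + g t" and one: "g 1 = 0"
    and bound: "\<And>t. 0 \<le> t \<Longrightarrow> t \<le> 1 \<Longrightarrow> norm (g t) \<le> K"
  shows "t \<ge> 0 \<Longrightarrow> g t = 0"
proof -
  assume t: "t \<ge> 0"
  have g0: "g 0 = 0" using add[of 0 0] by simp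
  have gn: "g (real n) = 0" for n by (induction n) (simp_all add: g0 add one)
  have mult: "g (real n * t) = real n *\<^sub>R g t" for n
    by (induction n) (simp_all add: g0 add distrib_right scaleR_add_left)
  have le: "real n * norm (g t) \<le> K" for n
  proof -
    define m where "m = nat \<lfloor>real n * t\<rfloor>"
    have m: "real m \<le> real n * t" "real n * t < real m + 1"
      using t by (simp_all add: m_def)
    have "g (real n * t) = g (real m) + g (real n * t - real m)" by (simp flip: add)
    then have "norm (real n *\<^sub>R g t) \<le> K"
      using bound[of "real n * t - real m"] m by (simp add: gn flip: mult)
    then show ?thesis by simp
  qed
  show "g t = 0"
  proof (rule ccontr)
    assume "g t \<noteq> 0"
    then obtain n where "K < real n * norm (g t)"
      using reals_Archimedean3[of "norm (g t)"] by auto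
    then show False using le[of n] by simp
  qed
qed

text \<open>The deviation of \<open>T (t a)\<close> from \<open>t T a\<close> is additive in
  \<open>t\<close> and vanishes at 1. For positive \<open>a\<close> the order bounds it on the unit
  interval, which kills it; differences of positive elements do the rest.\<close>

lemma additive_positive_linear:
  assumes add: "\<And>x y. star x = x \<Longrightarrow> star y = y \<Longrightarrow> T (x + y) = T x + T y"
    and pos: "\<And>x. x \<in> positive_cone \<Longrightarrow> T x \<in> positive_cone"
  shows "positive_linear_on_selfadjoint T"
proof -
  have T0: "T 0 = 0" using add[of 0 0] by simp
  have neg: "T (- x) = - T x" if "star x = x" for x
    using add[of x "- x"] that by (simp add: T0 star_minus eq_neg_iff_add_eq_0 add.commute)
  have diff: "T (x - y) = T x - T y" if "star x = x" "star y = y" for x y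
    using add[of x "- y"] neg[of y] that by (simp add: star_minus)
  have pos_hom: "T (r *\<^sub>R a) = r *\<^sub>R T a" if a: "a \<in> positive_cone" and r: "r \<ge> 0" for r a
  proof -
    define g where "g t = T (t *\<^sub>R a) - t *\<^sub>R T a" for t
    have sa: "star a = a" using a by (rule positive_cone_selfadjoint)
    have "g r = 0"
    proof (rule additive_bounded_zero[of g "2 * norm (T a)"])
      show "g (s + t) = g s + g t" for s t
        by (simp add: g_def scaleR_add_left add star_scaleR sa)
      show "norm (g t) \<le> 2 * norm (T a)" if t: "0 \<le> t" "t \<le> 1" for t
      proof -
        have "T a - T (t *\<^sub>R a) = T ((1 - t) *\<^sub>R a)"
          by (simp add: scaleR_diff_left diff star_scaleR sa)
        then have "norm (T (t *\<^sub>R a)) \<le> norm (T a)"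
          using a t by (intro norm_mono_positive) (simp_all add: pos positive_cone_scaleR)
        moreover have "norm (t *\<^sub>R T a) \<le> norm (T a)" using t by (simp add: mult_left_le_one_le)
        ultimately show ?thesis
          unfolding g_def using norm_triangle_ineq4[of "T (t *\<^sub>R a)" "t *\<^sub>R T a"] by linarith
      qed
    qed (simp_all add: g_def r)
    then show ?thesis by (simp add: g_def)
  qed
  have pos_hom': "T (r *\<^sub>R a) = r *\<^sub>R T a" if a: "a \<in> positive_cone" for r a
  proof (cases "r \<ge> 0")
    case False
    have "T (- ((- r) *\<^sub>R a)) = - T ((- r) *\<^sub>R a)"
      using positive_cone_selfadjoint[OF a] by (intro neg) (simp add: star_minus star_scaleR)
    then show ?thesis using pos_hom[OF a, of "- r"] False by simp
  qed (rule pos_hom[OF a])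
  have "T (r *\<^sub>R x) = r *\<^sub>R T x" if x: "star x = x" for r x
  proof -
    obtain a b where ab: "a \<in> positive_cone" "b \<in> positive_cone" "x = a - b"
      using selfadjoint_eq_diff_positive_definite[OF x] positive_definite_cone_subset by blast
    then show ?thesis
      by (simp add: scaleR_diff_right diff star_scaleR positive_cone_selfadjoint pos_hom')
  qed
  then show ?thesis using add pos by (simp add: positive_linear_on_selfadjoint_def)
qed

definition midpoint_affine :: "('a::cstar_algebra \<Rightarrow> 'b::cstar_algebra) \<Rightarrow> bool" where
  "midpoint_affine \<psi> \<longleftrightarrow> (\<forall>A\<in>positive_definite_cone. \<forall>B\<in>positive_definite_cone.
     \<psi> ((A + B) /\<^sub>R 2) = (\<psi> A + \<psi> B) /\<^sub>R 2)"

text \<open>Differences \<open>\<psi> A - \<psi> B\<close> depend only on \<open>A - B\<close>,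
  since \<open>A + B' = A' + B\<close> is an equality of midpoints up to the factor 2. This defines
  the linear part on all self-adjoint elements.\<close>

lemma midpoint_affine_extension:
  fixes \<psi> :: "'a::cstar_algebra \<Rightarrow> 'b::cstar_algebra"
  assumes mid: "midpoint_affine \<psi>"
    and maps: "\<And>A. A \<in> positive_definite_cone \<Longrightarrow> \<psi> A \<in> positive_definite_cone"
  shows "\<exists>T c. positive_linear_on_selfadjoint T \<and> c \<in> positive_cone \<and>
    (\<forall>A\<in>positive_definite_cone. \<psi> A = T A + c)"
proof -
  let ?P = "positive_definite_cone :: 'a set"
  note sa = positive_definite_cone_selfadjoint
  have mid: "\<psi> ((A + B) /\<^sub>R 2) = (\<psi> A + \<psi> B) /\<^sub>R 2" if "A \<in> ?P" "B \<in> ?P" for A B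
    using mid that by (simp add: midpoint_affine_def)
  have wd: "\<psi> A - \<psi> B = \<psi> A' - \<psi> B'"
    if "A \<in> ?P" "B \<in> ?P" "A' \<in> ?P" "B' \<in> ?P" "A - B = A' - B'" for A B A' B'
  proof -
    have "A + B' = A' + B" using that(5) by (simp add: algebra_simps)
    then have "(\<psi> A + \<psi> B') /\<^sub>R 2 = (\<psi> A' + \<psi> B) /\<^sub>R 2"
      using mid that by metis
    then have "\<psi> A + \<psi> B' = \<psi> A' + \<psi> B" by (simp only: scaleR_cancel_left) simp
    then show ?thesis by (simp add: algebra_simps)
  qed
  \<comment> \<open>A canonical way to write \<open>x\<close> as a difference of positive definite
    elements; \<open>wd\<close> shows that every other way gives the same value.\<close>
  define T where "T x = \<psi> (x + (norm x + 1) *\<^sub>R 1) - \<psi> ((norm x + 1) *\<^sub>R 1)" for x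
  have T: "T (A - B) = \<psi> A - \<psi> B" if A: "A \<in> ?P" and B: "B \<in> ?P" for A B
    unfolding T_def
  proof (rule wd)
    show "A - B + (norm (A - B) + 1) *\<^sub>R 1 \<in> ?P"
      by (rule selfadjoint_add_positive_definite) (simp add: star_diff sa A B)
    show "(norm (A - B) + 1) *\<^sub>R 1 \<in> ?P"
      by (intro positive_definite_cone_scaleR positive_definite_cone_one) (simp add: add_nonneg_pos)
  qed (simp_all add: A B)
  have T0: "T 0 = 0" using T[of 1 1] by (simp add: positive_definite_cone_one)
  have T_mid: "T ((x + y) /\<^sub>R 2) = (T x + T y) /\<^sub>R 2" if x: "star x = x" and y: "star y = y" for x y
  proof -
    obtain A B where A: "A \<in> ?P" "B \<in> ?P" "x = A - B"
      using selfadjoint_eq_diff_positive_definite[OF x] by blast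
    obtain A' B' where A': "A' \<in> ?P" "B' \<in> ?P" "y = A' - B'"
      using selfadjoint_eq_diff_positive_definite[OF y] by blast
    have "(x + y) /\<^sub>R 2 = (A + A') /\<^sub>R 2 - (B + B') /\<^sub>R 2"
      unfolding A A' by (simp add: algebra_simps)
    then have "T ((x + y) /\<^sub>R 2) = \<psi> ((A + A') /\<^sub>R 2) - \<psi> ((B + B') /\<^sub>R 2)"
      using A A' by (simp only: T mean_positive_definite)
    also have "\<dots> = (T x + T y) /\<^sub>R 2"
      using A A' by (simp only: mid T) (simp add: algebra_simps)
    finally show ?thesis .
  qed
  have T_half: "T (x /\<^sub>R 2) = T x /\<^sub>R 2" if "star x = x" for x
    using T_mid[OF that star_zero] by (simp add: T0)
  have T_add: "T (x + y) = T x + T y" if "star x = x" "star y = y" for x y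
    using T_mid[OF that] T_half[of "x + y"] that by (simp add: star_add)
  have T_nat: "T (real n *\<^sub>R x) = real n *\<^sub>R T x" if "star x = x" for n x
    by (induction n) (simp_all add: T0 T_add scaleR_add_left star_scaleR that)
  have T_nat_inv: "T ((1 / real (Suc n)) *\<^sub>R x) = (1 / real (Suc n)) *\<^sub>R T x" if "star x = x" for n x
  proof -
    have "real (Suc n) *\<^sub>R (1 / real (Suc n)) *\<^sub>R x = x" by simp
    then have "real (Suc n) *\<^sub>R T ((1 / real (Suc n)) *\<^sub>R x) = T x"
      using T_nat[of "(1 / real (Suc n)) *\<^sub>R x" "Suc n"] that by (simp only: star_scaleR)
    then have "(1 / real (Suc n)) *\<^sub>R real (Suc n) *\<^sub>R T ((1 / real (Suc n)) *\<^sub>R x) = (1 / real (Suc n)) *\<^sub>R T x"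
      by (simp only:)
    then show ?thesis by (simp del: of_nat_Suc)
  qed
  define c where "c = \<psi> 1 - T 1"
  have \<psi>: "\<psi> A = T A + c" if A: "A \<in> ?P" for A
  proof -
    have "T A = T (A - 1) + T 1"
      using T_add[of "A - 1" 1] sa[OF A] by (simp add: star_diff)
    then show ?thesis using T[OF A positive_definite_cone_one] by (simp add: c_def)
  qed
  \<comment> \<open>Dividing \<open>\<psi> (n A) = n T A + c\<close> by \<open>n\<close> and letting
    \<open>n\<close> grow removes the constant.\<close>
  have T_pd: "T A \<in> positive_cone" if A: "A \<in> ?P" for A
  proof (rule positive_cone_tendsto_shift)
    fix n
    have nA: "real (Suc n) *\<^sub>R A \<in> ?P" using A by (rule positive_definite_cone_scaleR) simp
    then have "\<psi> (real (Suc n) *\<^sub>R A) \<in> positive_cone"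
      using maps positive_definite_cone_subset by blast
    then have "(1 / real (Suc n)) *\<^sub>R \<psi> (real (Suc n) *\<^sub>R A) \<in> positive_cone"
      by (rule positive_cone_scaleR) simp
    moreover have "\<psi> (real (Suc n) *\<^sub>R A) = real (Suc n) *\<^sub>R T A + c"
      using \<psi>[OF nA] T_nat[OF sa[OF A]] by (simp only:)
    ultimately show "T A + (1 / real (Suc n)) *\<^sub>R c \<in> positive_cone"
      by (simp add: scaleR_add_right del: of_nat_Suc)
  qed
  have T_pos: "T A \<in> positive_cone" if A: "A \<in> positive_cone" for A
  proof (rule positive_cone_tendsto_shift)
    fix n
    have e: "(1 / real (Suc n)) *\<^sub>R 1 \<in> ?P"
      by (intro positive_definite_cone_scaleR positive_definite_cone_one) simp
    then have "T (A + (1 / real (Suc n)) *\<^sub>R 1) \<in> positive_cone"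
      using A by (intro T_pd) (simp only: add.commute[of A] positive_definite_cone_add_positive)
    then show "T A + (1 / real (Suc n)) *\<^sub>R T 1 \<in> positive_cone"
      using T_add[OF positive_cone_selfadjoint[OF A] sa[OF e]] T_nat_inv[OF star_one] by simp
  qed
  \<comment> \<open>\<open>c\<close> is the limit of the positive values of \<open>\<psi>\<close> at
    \<open>1 / n\<close>.\<close>
  have "c \<in> positive_cone"
  proof (rule positive_cone_tendsto_shift)
    fix n
    have e: "(1 / real (Suc n)) *\<^sub>R 1 \<in> ?P"
      by (intro positive_definite_cone_scaleR positive_definite_cone_one) simp
    have "\<psi> ((1 / real (Suc n)) *\<^sub>R 1) \<in> positive_cone"
      using maps[OF e] positive_definite_cone_subset by blast
    then show "c + (1 / real (Suc n)) *\<^sub>R T 1 \<in> positive_cone"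
      using \<psi>[OF e] T_nat_inv[OF star_one] by (simp add: add.commute)
  qed
  moreover have "positive_linear_on_selfadjoint T"
    using T_add T_pos by (rule additive_positive_linear)
  ultimately show ?thesis using \<psi> by blast
qed

text \<open>Replacing \<open>A\<close> by \<open>2 A\<close> in \<open>A = T' (T A) + T' c + c'\<close> shows \<open>T' c + c' = 0\<close>, a sum of two
  positive elements.\<close>

lemma inverse_affine_constant_zero:
  assumes T: "positive_linear_on_selfadjoint T" "c \<in> positive_cone"
    and T': "positive_linear_on_selfadjoint T'" "c' \<in> positive_cone"
    and inv: "\<And>A. A \<in> positive_definite_cone \<Longrightarrow> T' (T A + c) + c' = A"
  shows "c' = 0" and "star x = x \<Longrightarrow> T' (T x) = x"
proof -
  have eq: "T' (T A) + (T' c + c') = A" if A: "A \<in> positive_definite_cone" for A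
  proof -
    have "T' (T A + c) = T' (T A) + T' c"
      using A T by (intro positive_linear_add[OF T'(1)])
        (auto intro: positive_linear_selfadjoint positive_cone_selfadjoint positive_definite_cone_selfadjoint)
    then show ?thesis using inv[OF A] by (simp add: add.assoc)
  qed
  have "T' (T (2 *\<^sub>R 1)) = 2 *\<^sub>R T' (T 1)"
    by (simp add: positive_linear_scaleR[OF T(1)] positive_linear_scaleR[OF T'(1)]
        positive_linear_selfadjoint[OF T(1)])
  then have "2 *\<^sub>R T' (T 1) + (T' c + c') = 2 *\<^sub>R (T' (T 1) + (T' c + c'))"
    using eq[of "2 *\<^sub>R 1"] eq[of 1] by (simp add: positive_definite_cone_scaleR positive_definite_cone_one)
  then have zero: "T' c + c' = 0" by (simp add: scaleR_2 algebra_simps)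
  have "c' = - T' c" using zero by (simp add: eq_neg_iff_add_eq_0 add.commute)
  then have "- c' \<in> positive_cone" using positive_linear_positive[OF T'(1) T(2)] by simp
  then show "c' = 0" using positive_cone_antisym[OF T'(2)] by blast
  show "T' (T x) = x" if x: "star x = x"
  proof -
    obtain a b where ab: "a \<in> positive_definite_cone" "b \<in> positive_definite_cone" "x = a - b"
      using selfadjoint_eq_diff_positive_definite[OF x] by blast
    then have "T' (T x) = T' (T a) - T' (T b)"
      by (simp add: positive_linear_diff[OF T(1)] positive_linear_diff[OF T'(1)]
          positive_linear_selfadjoint[OF T(1)] positive_definite_cone_selfadjoint)
    then show ?thesis using eq[OF ab(1)] eq[OF ab(2)] ab(3) by (simp add: zero)
  qed
qed

lemma midpoint_affine_bijection:
  fixes \<psi> :: "'a::cstar_algebra \<Rightarrow> 'b::cstar_algebra"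
  assumes bij: "bij_betw \<psi> positive_definite_cone positive_definite_cone" and mid: "midpoint_affine \<psi>"
  shows "\<exists>T T'. positive_linear_on_selfadjoint T \<and> positive_linear_on_selfadjoint T' \<and>
    (\<forall>x. star x = x \<longrightarrow> T' (T x) = x) \<and> (\<forall>y. star y = y \<longrightarrow> T (T' y) = y) \<and>
    (\<forall>A\<in>positive_definite_cone. \<psi> A = T A)"
proof -
  define \<psi>' where "\<psi>' = inv_into positive_definite_cone \<psi>"
  have bij': "bij_betw \<psi>' positive_definite_cone positive_definite_cone"
    unfolding \<psi>'_def by (rule bij_betw_inv_into[OF bij])
  have maps: "\<psi> A \<in> positive_definite_cone" if "A \<in> positive_definite_cone" for A
    using bij_betwE[OF bij] that by blast
  have maps': "\<psi>' A \<in> positive_definite_cone" if "A \<in> positive_definite_cone" for A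
    using bij_betwE[OF bij'] that by blast
  have inv: "\<psi>' (\<psi> A) = A" if "A \<in> positive_definite_cone" for A
    unfolding \<psi>'_def using bij_betw_inv_into_left[OF bij that] .
  have inv': "\<psi> (\<psi>' A) = A" if "A \<in> positive_definite_cone" for A
    unfolding \<psi>'_def using bij_betw_inv_into_right[OF bij that] .
  have mid': "midpoint_affine \<psi>'"
    unfolding midpoint_affine_def
  proof (intro ballI)
    fix A B :: 'b assume AB: "A \<in> positive_definite_cone" "B \<in> positive_definite_cone"
    then have "\<psi> ((\<psi>' A + \<psi>' B) /\<^sub>R 2) = (A + B) /\<^sub>R 2"
      using mid unfolding midpoint_affine_def by (simp add: maps' inv')
    moreover have "(\<psi>' A + \<psi>' B) /\<^sub>R 2 \<in> positive_definite_cone"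
      using AB maps' by (intro mean_positive_definite)
    ultimately show "\<psi>' ((A + B) /\<^sub>R 2) = (\<psi>' A + \<psi>' B) /\<^sub>R 2" using inv by metis
  qed
  obtain T c where T: "positive_linear_on_selfadjoint T" "c \<in> positive_cone"
    and \<psi>: "\<And>A. A \<in> positive_definite_cone \<Longrightarrow> \<psi> A = T A + c"
    using midpoint_affine_extension[OF mid maps] by blast
  obtain T' c' where T': "positive_linear_on_selfadjoint T'" "c' \<in> positive_cone"
    and \<psi>': "\<And>A. A \<in> positive_definite_cone \<Longrightarrow> \<psi>' A = T' A + c'"
    using midpoint_affine_extension[OF mid' maps'] by blast
  have 1: "T' (T A + c) + c' = A" if "A \<in> positive_definite_cone" for A
    using \<psi>'[OF maps[OF that]] inv[OF that] by (simp add: \<psi> that)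
  have 2: "T (T' A + c') + c = A" if "A \<in> positive_definite_cone" for A
    using \<psi>[OF maps'[OF that]] inv'[OF that] by (simp add: \<psi>' that)
  \<comment> \<open>The roles of the map and its inverse are exchanged, so the constant that
    vanishes is that of \<open>\<psi>\<close>.\<close>
  have "c = 0" using inverse_affine_constant_zero(1)[OF T' T 2] .
  then show ?thesis
    using T(1) T'(1) \<psi> inverse_affine_constant_zero(2)[OF T T' 1] inverse_affine_constant_zero(2)[OF T' T 2]
    by (intro exI[of _ T] exI[of _ T']) simp
qed

lemma midpoint_affine_bijection_jordan:
  fixes \<psi> :: "'a::cstar_algebra \<Rightarrow> 'b::cstar_algebra"
  assumes bij: "bij_betw \<psi> positive_definite_cone positive_definite_cone" and mid: "midpoint_affine \<psi>"
  shows "\<exists>J D. jordan_star_isomorphism J \<and> D \<in> positive_definite_cone \<and>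
    (\<forall>A\<in>positive_definite_cone. \<psi> A = D * J A * D)"
proof -
  obtain T T' where T: "positive_linear_on_selfadjoint T" and T': "positive_linear_on_selfadjoint T'"
    and inv: "\<And>x. star x = x \<Longrightarrow> T' (T x) = x" "\<And>y. star y = y \<Longrightarrow> T (T' y) = y"
    and \<psi>: "\<And>A. A \<in> positive_definite_cone \<Longrightarrow> \<psi> A = T A"
    using midpoint_affine_bijection[OF bij mid] by blast
  have pd: "T 1 \<in> positive_definite_cone"
    using \<psi>[of 1] bij_betwE[OF bij] positive_definite_cone_one by metis
  \<comment> \<open>\<open>E\<close> is the inverse of \<open>D\<close>; conjugation by
    \<open>E\<close> normalizes \<open>T\<close> to a unital map, since
    \<open>D * D = T 1\<close>.\<close>
  define D E where "D = real_power (T 1) (1/2)" and "E = real_power (T 1) (- 1/2)"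
  have D: "D \<in> positive_definite_cone" "star D = D" "star E = E"
    using real_power_positive_definite[OF pd] positive_definite_cone_selfadjoint
    by (auto simp: D_def E_def)
  have DD: "D * D = T 1" and DE: "D * E = 1" and ED: "E * D = 1"
    using real_power_add[OF pd, of "1/2" "1/2"] real_power_add[OF pd, of "1/2" "- 1/2"]
      real_power_add[OF pd, of "- 1/2" "1/2"] real_power_one[OF pd] real_power_zero[OF pd]
    by (simp_all add: D_def E_def)
  have cancel: "D * (E * x * E) * D = x" "E * (D * x * D) * E = x" for x
  proof -
    have "D * (E * x * E) * D = (D * E) * x * (E * D)" "E * (D * x * D) * E = (E * D) * x * (D * E)"
      by (simp_all only: mult.assoc)
    then show "D * (E * x * E) * D = x" "E * (D * x * D) * E = x" by (simp_all add: DE ED)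
  qed
  define S where "S x = E * T x * E" for x
  define S' where "S' y = T' (D * y * D)" for y
  have S: "positive_linear_on_selfadjoint S"
    unfolding positive_linear_on_selfadjoint_def S_def using D
    by (auto simp: positive_linear_add[OF T] positive_linear_scaleR[OF T] distrib_left distrib_right
        intro: positive_cone_conjugate positive_linear_positive[OF T])
  have sD: "star (D * y * D) = D * y * D" if "star y = y" for y
    using that D by (simp add: star_mult mult.assoc)
  have S': "positive_linear_on_selfadjoint S'"
    unfolding positive_linear_on_selfadjoint_def S'_def using D
    by (auto simp: positive_linear_add[OF T'] positive_linear_scaleR[OF T'] distrib_left distrib_right sD
        intro: positive_cone_conjugate positive_linear_positive[OF T'])
  have S1: "S 1 = 1" using cancel(2)[of 1] by (simp add: S_def DD)
  have S'1: "S' 1 = 1" by (simp add: S'_def DD inv)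
  have "S' (S x) = x" if "star x = x" for x
    using that by (simp add: S_def S'_def cancel inv)
  moreover have "S (S' y) = y" if "star y = y" for y
    using that by (simp add: S_def S'_def cancel inv sD)
  ultimately obtain J where J: "jordan_star_isomorphism J" "\<And>x. star x = x \<Longrightarrow> J x = S x"
    using unital_order_isomorphism_extends_to_jordan[OF S S1 S' S'1] by blast
  have "\<psi> A = D * J A * D" if "A \<in> positive_definite_cone" for A
    using J(2)[OF positive_definite_cone_selfadjoint[OF that]] \<psi>[OF that] by (simp add: S_def cancel)
  then show ?thesis using J(1) D(1) by blast
qed

lemma bij_betw_real_power:
  assumes "p \<noteq> 0"
  shows "bij_betw (\<lambda>A. real_power A p) (positive_definite_cone :: 'a::cstar_algebra set) positive_definite_cone"
  by (rule bij_betw_byWitness[where f' = "\<lambda>A. real_power A (1 / p)"])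
    (auto simp: assms real_power_inverse real_power_positive_definite)

theorem theorem1:
  fixes p :: real
    and \<phi> :: "'a::cstar_algebra \<Rightarrow> 'b::cstar_algebra"
  assumes "p \<noteq> 0"
    and "bij_betw \<phi> positive_definite_cone positive_definite_cone"
  shows "(\<forall>A\<in>positive_definite_cone. \<forall>B\<in>positive_definite_cone.
            \<phi> (power_mean p A B) = power_mean p (\<phi> A) (\<phi> B)) \<longleftrightarrow>
         (\<exists>(J :: 'a \<Rightarrow> 'b) D. jordan_star_isomorphism J \<and> D \<in> positive_definite_cone \<and>
            (\<forall>A\<in>positive_definite_cone. \<phi> A = real_power (D * real_power (J A) p * D) (1 / p)))"
    (is "?mean \<longleftrightarrow> ?form")
proof
  assume mean: ?mean
  note [simp] = real_power_positive_definite mean_positive_definite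
  have \<phi>: "\<phi> A \<in> positive_definite_cone" if "A \<in> positive_definite_cone" for A
    using bij_betwE[OF assms(2)] that by blast
  define \<psi> where "\<psi> A = real_power (\<phi> (real_power A (1 / p))) p" for A
  have "bij_betw ((\<lambda>A. real_power A p) \<circ> \<phi> \<circ> (\<lambda>A. real_power A (1 / p)))
      positive_definite_cone positive_definite_cone"
    using assms by (intro bij_betw_trans[OF bij_betw_trans[OF bij_betw_real_power assms(2)] bij_betw_real_power,
          unfolded comp_assoc[symmetric]]) simp_all
  then have bij: "bij_betw \<psi> positive_definite_cone positive_definite_cone"
    by (simp add: \<psi>_def[abs_def] comp_def)
  have "midpoint_affine \<psi>"
    unfolding midpoint_affine_def
  proof (intro ballI)
    fix A B :: 'a assume AB: "A \<in> positive_definite_cone" "B \<in> positive_definite_cone"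
    \<comment> \<open>The outer and inner powers in the power mean cancel at \<open>1 / p\<close>-th
      powers, leaving the arithmetic mean inside.\<close>
    then have "real_power ((A + B) /\<^sub>R 2) (1 / p) = power_mean p (real_power A (1 / p)) (real_power B (1 / p))"
      using assms(1) by (simp add: power_mean_def real_power_inverse)
    then have eq: "\<phi> (real_power ((A + B) /\<^sub>R 2) (1 / p)) = real_power ((\<psi> A + \<psi> B) /\<^sub>R 2) (1 / p)"
      using mean AB by (simp add: power_mean_def \<psi>_def)
    have "(\<psi> A + \<psi> B) /\<^sub>R 2 \<in> positive_definite_cone"
      using AB bij_betwE[OF bij] by (intro mean_positive_definite) auto
    then show "\<psi> ((A + B) /\<^sub>R 2) = (\<psi> A + \<psi> B) /\<^sub>R 2"
      unfolding \<psi>_def[of "(A + B) /\<^sub>R 2"] eq by (rule real_power_inverse(2)[OF _ assms(1)])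
  qed
  then obtain J D where J: "jordan_star_isomorphism J" and D: "D \<in> positive_definite_cone"
    and \<psi>: "\<And>A. A \<in> positive_definite_cone \<Longrightarrow> \<psi> A = D * J A * D"
    using midpoint_affine_bijection_jordan[OF bij] by blast
  have "\<phi> A = real_power (D * real_power (J A) p * D) (1 / p)" if A: "A \<in> positive_definite_cone" for A
  proof -
    have "real_power (\<phi> A) p = D * real_power (J A) p * D"
      \<comment> \<open>Substituting \<open>A^p\<close> undoes the inner power in
        \<open>\<psi>\<close>, and \<open>J\<close> commutes with powers.\<close>
      using \<psi>[of "real_power A p"] A assms(1) by (simp add: \<psi>_def real_power_inverse jordan_real_power[OF J])
    then show ?thesis using real_power_inverse(1)[OF \<phi>[OF A] assms(1)] by simp
  qed
  then show ?form using J D by blast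
next
  assume ?form
  then show ?mean using jordan_conjugate_preserves_power_mean assms(1) by blast
qed

end
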